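(* Let $n=us$ and let $h,z',A,y$ be the random signal, noise, measurement matrix and measurements described in the context, with $k_u<u$. Let $\xi\ge 0$ be the energy threshold, let $\epsilon>0$, let $P_{\mathrm{md}}(\xi)$ be the probability that a given active user is missed by the hierarchical thresholding detector, let $\mathbb{P}_{\overline{\mathrm{sRIP}}}(\epsilon)$ be the probability (over $h$, $z'$ and $A$) that the energy-preservation condition $$\max_{i\in[u],\ \omega\in\Omega_i}\Big|\sum_{j\in\omega}|(h+z')_j|^2-\sum_{j\in\omega}|(A^Hy)_j|^2\Big|\le\epsilon$$ fails, and let $F^z(x):=\mathbb{P}\big(\|(h_i+z_i')_{\mathcal{A}_i}\|^2\le x\big)$ for an active user $i$ with path support $\mathcal{A}_i$. Then $$P_{\mathrm{md}}(\xi)\;\le\;\mathbb{P}_{\overline{\mathrm{sRIP}}}(\epsilon)\;+\;2s(u-k_u)\,F^z(\xi+4\epsilon)\;+\;n^{-k_s}\,\mathrm{SNR}^{-k_s}\Big(\frac{us}{2k_sm}\Big)^{-k_s}s\,(u-k_u).$$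
   Context: All norms $\|\cdot\|$ are $\ell_2$-norms. $u,s,k_u,k_s,m$ are positive integers with $k_u\le u$, $k_s\le s$, $n=us$, $m\le n$; $[u]$ indexes the $u$ blocks. Signal model. $h=[h_1^T\,\dots\,h_u^T]^T\in\mathbb{C}^{n}$ consists of $u$ blocks $h_i\in\mathbb{C}^s$, one per user. A vector is (hierarchically) $(k_u,k_s)$-sparse if at most $k_u$ blocks have non-vanishing entries and each of these blocks has at most $k_s$ non-zero entries. The set of active users is a uniformly random subset of the users of size $k_u$; for each active user $i$ the support $\mathcal{A}_i$ of $h_i$ is a uniformly random subset of size $k_s$ of the $s$ positions of block $i$; the non-zero entries are independent $\mathcal{CN}(0,1)$ (circularly symmetric complex Gaussian with unit variance); $h_i=0$ for inactive users. Measurements. $y=A(h+z')\in\mathbb{C}^m$, where $z'\sim\mathcal{CN}(0,\frac{\sigma^2m}{n^2}I_n)$ with blocks $z'_i$, and $A=\sqrt{n/m}\,W_{\mathcal{B}}\in\mathbb{C}^{m\times n}$ is a randomly subsampled FFT: $W\in\mathbb{C}^{n\times n}$ is the unitary Fourier matrix $W_{kl}=n^{-1/2}e^{-2\pi\imath kl/n}$ and $W_{\mathcal{B}}$ its restriction to the rows in a uniformly random set $\mathcal{B}$ of $m$ indices. $h,z',A$ are independent. $\mathrm{SNR}:=1/\sigma^2$. $\Omega_i$ is the set of all index sets of cardinality $k_s$ contained in the $i$-th block. For a vector $x$ and index set $\omega$, $x_\omega$ is the restriction of $x$ to $\omega$. Detector. User detection is based on the linear estimation (first) step of the hierarchical thresholding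 algorithms HiHTP/HiIHT: let $x=A^Hy$, let $L_{k_u,k_s}(x)$ be the support of a best $\ell_2$-approximation of $x$ by a $(k_u,k_s)$-sparse vector (obtained by keeping the $k_s$ largest-modulus entries in each block and then the $k_u$ blocks with largest $\ell_2$-norm after this reduction), and let $h^\ast$ be the restriction of $x$ to $L_{k_u,k_s}(x)$ (zero elsewhere), with blocks $h^\ast_i$. User $i$ is declared active if and only if its block is among the $k_u$ selected ones and $\|h^\ast_i\|\ge\sqrt{\xi}$. An active user is missed if it is not declared active; by symmetry the probability $P_{\mathrm{md}}(\xi)$ of this event is the same for all active users. *)

theory Defs
  imports "HOL-Probability.Probability"
begin

text \<open>
  A vector of length \<open>u * s\<close> is a function \<open>nat \<Rightarrow> complex\<close> of which only the values on
  \<open>{..<u * s}\<close> matter. Users and coordinates are numbered from 0; coordinate \<open>j\<close> belongs to user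
  \<open>j div s\<close>.
\<close>

definition block :: "nat \<Rightarrow> nat \<Rightarrow> nat set"
  where "block s i = {i * s..<Suc i * s}"

definition Omega :: "nat \<Rightarrow> nat \<Rightarrow> nat \<Rightarrow> nat set set"
  where "Omega s ks i = {\<omega>. \<omega> \<subseteq> block s i \<and> card \<omega> = ks}"

definition restrict_vec :: "nat set \<Rightarrow> (nat \<Rightarrow> complex) \<Rightarrow> nat \<Rightarrow> complex"
  where "restrict_vec I x = (\<lambda>j. if j \<in> I then x j else 0)"

definition norm_on :: "nat set \<Rightarrow> (nat \<Rightarrow> complex) \<Rightarrow> real"
  where "norm_on I x = L2_set (\<lambda>j. cmod (x j)) I"


subsection \<open>Distributions of signal, noise and sampled rows\<close>

text \<open>Circularly symmetric complex Gaussian with variance \<open>v\<close>: the real and imaginary parts are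
  independent and normal with variance \<open>v / 2\<close> each (\<open>normal_density\<close> takes the standard
  deviation).\<close>

definition complex_normal :: "real \<Rightarrow> complex measure"
  where "complex_normal v =
    distr (density lborel (normal_density 0 (sqrt (v / 2))) \<Otimes>\<^sub>M
           density lborel (normal_density 0 (sqrt (v / 2))))
      borel (\<lambda>(a, b). Complex a b)"

definition complex_normal_vec :: "nat \<Rightarrow> real \<Rightarrow> (nat \<Rightarrow> complex) measure"
  where "complex_normal_vec n v = (\<Pi>\<^sub>M j\<in>{..<n}. complex_normal v)"

definition uniform_subset :: "nat set \<Rightarrow> nat \<Rightarrow> nat set measure"
  where "uniform_subset X k = uniform_count_measure {I. I \<subseteq> X \<and> card I = k}"

text \<open>Joint law of the active users \<open>U\<close>, the path supports \<open>S\<close> and the signal \<open>h\<close>. A support is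
  drawn for every user, independently, but the supports of inactive users do not enter \<open>h\<close>.\<close>

definition signal_law ::
    "nat \<Rightarrow> nat \<Rightarrow> nat \<Rightarrow> nat \<Rightarrow> (nat set \<times> (nat \<Rightarrow> nat set) \<times> (nat \<Rightarrow> complex)) measure"
  where "signal_law u s ku ks =
    (let \<mu> = uniform_subset {..<u} ku;
         \<nu> = (\<Pi>\<^sub>M i\<in>{..<u}. uniform_subset (block s i) ks)
     in distr (\<mu> \<Otimes>\<^sub>M \<nu> \<Otimes>\<^sub>M complex_normal_vec (u * s) 1)
          (\<mu> \<Otimes>\<^sub>M \<nu> \<Otimes>\<^sub>M (\<Pi>\<^sub>M j\<in>{..<u * s}. borel))
          (\<lambda>(U, S, g). (U, S,
             \<lambda>j\<in>{..<u * s}. if j div s \<in> U \<and> j \<in> S (j div s) then g j else 0)))"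

definition noise_law :: "nat \<Rightarrow> nat \<Rightarrow> real \<Rightarrow> (nat \<Rightarrow> complex) measure"
  where "noise_law n m \<sigma> = complex_normal_vec n (\<sigma>\<^sup>2 * real m / (real n)\<^sup>2)"

definition SNR :: "real \<Rightarrow> real"
  where "SNR \<sigma> = 1 / \<sigma>\<^sup>2"

text \<open>That the joint law is a product expresses the independence of signal, noise and measurement
  matrix; the library's \<open>indep_var\<close> would require all three to have the same type.\<close>

definition access_model ::
    "'w measure \<Rightarrow> nat \<Rightarrow> nat \<Rightarrow> nat \<Rightarrow> nat \<Rightarrow> nat \<Rightarrow> real \<Rightarrow>
     ('w \<Rightarrow> nat set) \<Rightarrow> ('w \<Rightarrow> nat \<Rightarrow> nat set) \<Rightarrow> ('w \<Rightarrow> nat \<Rightarrow> complex) \<Rightarrow>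
     ('w \<Rightarrow> nat \<Rightarrow> complex) \<Rightarrow> ('w \<Rightarrow> nat set) \<Rightarrow> bool"
  where "access_model M u s ku ks m \<sigma> act supp h z B \<longleftrightarrow>
    (let law = signal_law u s ku ks \<Otimes>\<^sub>M noise_law (u * s) m \<sigma> \<Otimes>\<^sub>M uniform_subset {..<u * s} m;
         X = (\<lambda>w. ((act w, supp w, h w), z w, B w))
     in prob_space M \<and> X \<in> M \<rightarrow>\<^sub>M law \<and> distr M law X = law)"


subsection \<open>Measurements\<close>

definition fourier :: "nat \<Rightarrow> nat \<Rightarrow> nat \<Rightarrow> complex"
  where "fourier n k l =
    complex_of_real (1 / sqrt (real n)) * exp (- 2 * of_real pi * \<i> * of_nat k * of_nat l / of_nat n)"

text \<open>The rows of the \<open>m \<times> n\<close> matrix \<open>A\<close>, and the entries of \<open>y\<close>, are indexed by the \<open>m\<close> elements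
  of the sampled set \<open>B\<close> rather than by \<open>{..<m}\<close>.\<close>

definition meas_matrix :: "nat \<Rightarrow> nat \<Rightarrow> nat \<Rightarrow> nat \<Rightarrow> complex"
  where "meas_matrix n m k l = complex_of_real (sqrt (real n / real m)) * fourier n k l"

definition measurement :: "nat \<Rightarrow> nat \<Rightarrow> (nat \<Rightarrow> complex) \<Rightarrow> (nat \<Rightarrow> complex) \<Rightarrow> nat \<Rightarrow> complex"
  where "measurement n m h z k = (\<Sum>l<n. meas_matrix n m k l * (h l + z l))"

definition adjoint_apply :: "nat \<Rightarrow> nat \<Rightarrow> nat set \<Rightarrow> (nat \<Rightarrow> complex) \<Rightarrow> nat \<Rightarrow> complex"
  where "adjoint_apply n m B y j = (\<Sum>k\<in>B. cnj (meas_matrix n m k j) * y k)"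

definition linear_estimate ::
    "nat \<Rightarrow> nat \<Rightarrow> (nat \<Rightarrow> complex) \<Rightarrow> (nat \<Rightarrow> complex) \<Rightarrow> nat set \<Rightarrow> nat \<Rightarrow> complex"
  where "linear_estimate n m h z B = adjoint_apply n m B (measurement n m h z)"


subsection \<open>Hierarchical thresholding\<close>

definition hier_sparse :: "nat \<Rightarrow> nat \<Rightarrow> nat \<Rightarrow> nat \<Rightarrow> (nat \<Rightarrow> complex) \<Rightarrow> bool"
  where "hier_sparse u s ku ks v \<longleftrightarrow>
    card {i\<in>{..<u}. \<exists>j\<in>block s i. v j \<noteq> 0} \<le> ku \<and>
    (\<forall>i<u. card {j\<in>block s i. v j \<noteq> 0} \<le> ks)"

text \<open>\<open>L\<close> is a possible value of \<open>L_{ku,ks}(x)\<close>. Ties are resolved arbitrarily, so this is a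
  relation; \<open>\<omega> i\<close> are the entries kept in block \<open>i\<close> and \<open>U\<close> are the selected blocks.\<close>

definition hier_threshold :: "nat \<Rightarrow> nat \<Rightarrow> nat \<Rightarrow> nat \<Rightarrow> (nat \<Rightarrow> complex) \<Rightarrow> nat set \<Rightarrow> bool"
  where "hier_threshold u s ku ks x L \<longleftrightarrow>
    (\<exists>\<omega> U.
      (\<forall>i<u. \<omega> i \<in> Omega s ks i \<and> (\<forall>j\<in>\<omega> i. \<forall>l\<in>block s i - \<omega> i. cmod (x l) \<le> cmod (x j))) \<and>
      U \<subseteq> {..<u} \<and> card U = ku \<and>
      (\<forall>i\<in>U. \<forall>i'\<in>{..<u} - U. norm_on (\<omega> i') x \<le> norm_on (\<omega> i) x) \<and>
      L = (\<Union>i\<in>U. \<omega> i))"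

definition declared_active :: "nat \<Rightarrow> real \<Rightarrow> (nat \<Rightarrow> complex) \<Rightarrow> nat set \<Rightarrow> nat \<Rightarrow> bool"
  where "declared_active s \<xi> x L i \<longleftrightarrow>
    L \<inter> block s i \<noteq> {} \<and> norm_on (block s i) (restrict_vec L x) \<ge> sqrt \<xi>"


subsection \<open>The three probabilities\<close>

text \<open>Statements about a given active user \<open>i\<close> are conditional on \<open>i\<close> being active.\<close>

definition P_md ::
    "'w measure \<Rightarrow> nat \<Rightarrow> nat \<Rightarrow> nat \<Rightarrow> ('w \<Rightarrow> nat set) \<Rightarrow> ('w \<Rightarrow> nat \<Rightarrow> complex) \<Rightarrow>
     ('w \<Rightarrow> nat \<Rightarrow> complex) \<Rightarrow> ('w \<Rightarrow> nat set) \<Rightarrow> ('w \<Rightarrow> nat set) \<Rightarrow> nat \<Rightarrow> real \<Rightarrow> real"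
  where "P_md M u s m act h z B L i \<xi> =
    \<P>(w in M. \<not> declared_active s \<xi> (linear_estimate (u * s) m (h w) (z w) (B w)) (L w) i
      \<bar> i \<in> act w)"

definition energy_preserving ::
    "nat \<Rightarrow> nat \<Rightarrow> nat \<Rightarrow> nat \<Rightarrow> real \<Rightarrow> (nat \<Rightarrow> complex) \<Rightarrow> (nat \<Rightarrow> complex) \<Rightarrow> nat set \<Rightarrow> bool"
  where "energy_preserving u s ks m \<epsilon> h z B \<longleftrightarrow>
    (MAX (i, \<omega>) \<in> (SIGMA i:{..<u}. Omega s ks i).
       \<bar>(\<Sum>j\<in>\<omega>. (cmod (h j + z j))\<^sup>2)
         - (\<Sum>j\<in>\<omega>. (cmod (linear_estimate (u * s) m h z B j))\<^sup>2)\<bar>) \<le> \<epsilon>"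

definition P_sRIP_fail ::
    "'w measure \<Rightarrow> nat \<Rightarrow> nat \<Rightarrow> nat \<Rightarrow> nat \<Rightarrow> ('w \<Rightarrow> nat \<Rightarrow> complex) \<Rightarrow>
     ('w \<Rightarrow> nat \<Rightarrow> complex) \<Rightarrow> ('w \<Rightarrow> nat set) \<Rightarrow> real \<Rightarrow> real"
  where "P_sRIP_fail M u s ks m h z B \<epsilon> =
    \<P>(w in M. \<not> energy_preserving u s ks m \<epsilon> (h w) (z w) (B w))"

definition F_z ::
    "'w measure \<Rightarrow> ('w \<Rightarrow> nat set) \<Rightarrow> ('w \<Rightarrow> nat \<Rightarrow> nat set) \<Rightarrow> ('w \<Rightarrow> nat \<Rightarrow> complex) \<Rightarrow>
     ('w \<Rightarrow> nat \<Rightarrow> complex) \<Rightarrow> nat \<Rightarrow> real \<Rightarrow> real"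
  where "F_z M act supp h z i x =
    \<P>(w in M. (norm_on (supp w i) (\<lambda>j. h w j + z w j))\<^sup>2 \<le> x \<bar> i \<in> act w)"


subsection \<open>Thresholding yields a best hierarchically sparse approximation\<close>

lemma sum_le_sum_largest:
  fixes f :: "'a \<Rightarrow> real"
  assumes "finite S" "T \<subseteq> S" "C \<subseteq> S" "card C \<le> card T"
    and top: "\<And>a b. a \<in> T \<Longrightarrow> b \<in> S - T \<Longrightarrow> f b \<le> f a" and nn: "\<And>a. 0 \<le> f a"
  shows "sum f C \<le> sum f T"
proof -
  have fin: "finite T" "finite C" using assms finite_subset by blast+
  have "card (C - T) \<le> card (T - C)"
    using card_Int_Diff[OF fin(1), of C] card_Int_Diff[OF fin(2), of T] assms(4)
    by (simp add: Int_commute)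
  then obtain g where g: "inj_on g (C - T)" "g ` (C - T) \<subseteq> T - C"
    using fin card_le_inj[of "C - T" "T - C"] by auto
  have "sum f (C - T) \<le> sum (\<lambda>b. f (g b)) (C - T)"
    using g assms(3) by (intro sum_mono top) auto
  also have "\<dots> = sum f (g ` (C - T))" by (simp add: sum.reindex[OF g(1)])
  also have "\<dots> \<le> sum f (T - C)" using g fin nn by (intro sum_mono2) auto
  finally show ?thesis
    using sum.Int_Diff[OF fin(1), of f C] sum.Int_Diff[OF fin(2), of f T]
    by (simp add: Int_commute)
qed

lemma Union_block: "(\<Union>i<u. block s i) = {..<u * s}"
proof (induction u)
  case (Suc u)
  then show ?case by (auto simp: lessThan_Suc block_def)
qed simp

lemma in_block_iff:
  assumes s: "0 < s"
  shows "j \<in> block s i \<longleftrightarrow> j div s = i"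
proof
  assume "j \<in> block s i"
  then show "j div s = i"
    by (intro div_nat_eqI) (auto simp: block_def algebra_simps)
next
  assume "j div s = i"
  then show "j \<in> block s i"
    using div_mult_mod_eq[of j s] mod_less_divisor[OF s, of j] by (auto simp: block_def)
qed

lemma norm_on_sq: "(norm_on I x)\<^sup>2 = (\<Sum>j\<in>I. (cmod (x j))\<^sup>2)"
  by (simp add: norm_on_def L2_set_def sum_nonneg)

lemma sum_blocks:
  assumes "0 < s"
  shows "sum f {..<u * s} = (\<Sum>i<u. sum f (block s i))"
proof -
  have "sum f (\<Union>i\<in>{..<u}. block s i) = (\<Sum>i<u. sum f (block s i))"
  proof (rule sum.UNION_disjoint)
    show "\<forall>i\<in>{..<u}. finite (block s i)" by (simp add: block_def)
    show "\<forall>i\<in>{..<u}. \<forall>i'\<in>{..<u}. i \<noteq> i' \<longrightarrow> block s i \<inter> block s i' = {}"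
      using in_block_iff[OF assms] by auto
  qed simp
  then show ?thesis by (simp only: Union_block)
qed

lemma hier_threshold_best_approximation:
  assumes s: "0 < s" and L: "hier_threshold u s ku ks x L"
  shows "hier_sparse u s ku ks (restrict_vec L x)"
    and "hier_sparse u s ku ks v \<Longrightarrow>
      norm_on {..<u * s} (\<lambda>j. x j - restrict_vec L x j) \<le> norm_on {..<u * s} (\<lambda>j. x j - v j)"
proof -
  obtain \<omega> U where
    \<omega>: "\<And>i. i < u \<Longrightarrow> \<omega> i \<subseteq> block s i \<and> card (\<omega> i) = ks"
    and \<omega>max: "\<And>i j l. i < u \<Longrightarrow> j \<in> \<omega> i \<Longrightarrow> l \<in> block s i - \<omega> i \<Longrightarrow> cmod (x l) \<le> cmod (x j)"
    and U: "U \<subseteq> {..<u}" "card U = ku"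
    and Umax: "\<And>i i'. i \<in> U \<Longrightarrow> i' \<in> {..<u} - U \<Longrightarrow> norm_on (\<omega> i') x \<le> norm_on (\<omega> i) x"
    and LU: "L = (\<Union>i\<in>U. \<omega> i)"
    using L unfolding hier_threshold_def Omega_def mem_Collect_eq by metis
  have finU: "finite U" using U(1) finite_subset by blast
  have finb: "finite (block s i)" for i by (simp add: block_def)
  have LB: "L \<inter> block s i = (if i \<in> U then \<omega> i else {})" for i
  proof -
    have "i' = i" if "i' \<in> U" "j \<in> \<omega> i'" "j \<in> block s i" for i' j
    proof -
      have "j \<in> block s i'" using that(1,2) \<omega>[of i'] U(1) by blast
      then show ?thesis using that(3) by (simp add: in_block_iff[OF s])
    qed
    moreover have "\<omega> i \<subseteq> block s i" if "i \<in> U"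
      using that \<omega> U(1) by blast
    ultimately show ?thesis unfolding LU by auto
  qed
  show "hier_sparse u s ku ks (restrict_vec L x)"
    unfolding hier_sparse_def
  proof (intro conjI allI impI)
    have "{i\<in>{..<u}. \<exists>j\<in>block s i. restrict_vec L x j \<noteq> 0} \<subseteq> U"
    proof safe
      fix i j assume "j \<in> block s i" "restrict_vec L x j \<noteq> 0"
      then have "j \<in> L \<inter> block s i" by (auto simp: restrict_vec_def split: if_splits)
      then show "i \<in> U" using LB[of i] by (cases "i \<in> U") auto
    qed
    then show "card {i\<in>{..<u}. \<exists>j\<in>block s i. restrict_vec L x j \<noteq> 0} \<le> ku"
      using card_mono[OF finU] U(2) by fastforce
  next
    fix i assume i: "i < u"
    have "{j\<in>block s i. restrict_vec L x j \<noteq> 0} \<subseteq> \<omega> i"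
      using LB[of i] by (auto simp: restrict_vec_def split: if_splits)
    then show "card {j\<in>block s i. restrict_vec L x j \<noteq> 0} \<le> ks"
      using \<omega>[OF i] card_mono finite_subset[OF _ finb] by metis
  qed
  show "norm_on {..<u * s} (\<lambda>j. x j - restrict_vec L x j) \<le> norm_on {..<u * s} (\<lambda>j. x j - v j)"
    if v: "hier_sparse u s ku ks v"
  proof -
    define e where "e j = (cmod (x j))\<^sup>2" for j
    define V where "V = {i\<in>{..<u}. \<exists>j\<in>block s i. v j \<noteq> 0}"
    define C where "C i = {j\<in>block s i. v j \<noteq> 0}" for i
    have finV: "finite V" by (simp add: V_def)
    have keep: "(\<Sum>j\<in>C i. e j) \<le> (\<Sum>j\<in>\<omega> i. e j)" if "i < u" for i
    proof (rule sum_le_sum_largest[OF finb])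
      show "\<omega> i \<subseteq> block s i" "C i \<subseteq> block s i" using \<omega>[OF that] by (simp_all add: C_def)
      show "card (C i) \<le> card (\<omega> i)"
        using v \<omega>[OF that] that by (simp add: C_def hier_sparse_def)
      show "e b \<le> e a" if "a \<in> \<omega> i" "b \<in> block s i - \<omega> i" for a b
        using \<omega>max[OF \<open>i < u\<close> that] by (simp add: e_def power_mono)
      show "0 \<le> e a" for a by (simp add: e_def)
    qed
    have "(\<Sum>i<u. \<Sum>j\<in>C i. e j) = (\<Sum>i\<in>V. \<Sum>j\<in>C i. e j)"
      by (intro sum.mono_neutral_right) (auto simp: V_def C_def intro!: sum.neutral)
    also have "\<dots> \<le> (\<Sum>i\<in>V. \<Sum>j\<in>\<omega> i. e j)"
      using keep by (intro sum_mono) (auto simp: V_def)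
    also have "\<dots> \<le> (\<Sum>i\<in>U. \<Sum>j\<in>\<omega> i. e j)"
    proof (rule sum_le_sum_largest[of "{..<u}"])
      show "card V \<le> card U" using v U by (simp add: V_def hier_sparse_def)
      show "(\<Sum>j\<in>\<omega> b. e j) \<le> (\<Sum>j\<in>\<omega> a. e j)" if "a \<in> U" "b \<in> {..<u} - U" for a b
        using power_mono[OF Umax[OF that], of 2]
        by (simp add: norm_on_sq e_def) (simp add: norm_on_def)
    qed (use U in \<open>auto simp: V_def e_def sum_nonneg\<close>)
    also have "\<dots> = (\<Sum>i\<in>U. \<Sum>j\<in>L \<inter> block s i. e j)"
      by (intro sum.cong) (auto simp: LB)
    also have "\<dots> = (\<Sum>i<u. \<Sum>j\<in>L \<inter> block s i. e j)"
      using U by (intro sum.mono_neutral_left) (auto simp: LB)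
    finally have le: "(\<Sum>i<u. \<Sum>j\<in>C i. e j) \<le> (\<Sum>i<u. \<Sum>j\<in>L \<inter> block s i. e j)" .
    have spl: "(\<Sum>j\<in>block s i. e j) = (\<Sum>j\<in>L \<inter> block s i. e j) + (\<Sum>j\<in>block s i - L. e j)" for i
      using sum.Int_Diff[OF finb, of e i L] by (simp add: Int_commute)
    have spl': "(\<Sum>j\<in>block s i. e j) = (\<Sum>j\<in>C i. e j) + (\<Sum>j\<in>block s i - C i. e j)" for i
      using sum.subset_diff[of "C i" "block s i" e] finb by (auto simp: C_def)
    have "(norm_on {..<u * s} (\<lambda>j. x j - restrict_vec L x j))\<^sup>2 = (\<Sum>i<u. \<Sum>j\<in>block s i - L. e j)"
      unfolding norm_on_sq sum_blocks[OF s]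
      by (intro sum.cong refl sum.mono_neutral_cong_right finb)
        (auto simp: restrict_vec_def e_def)
    also have "\<dots> \<le> (\<Sum>i<u. \<Sum>j\<in>block s i - C i. e j)"
    proof -
      have "(\<Sum>i<u. \<Sum>j\<in>block s i. e j) =
        (\<Sum>i<u. \<Sum>j\<in>L \<inter> block s i. e j) + (\<Sum>i<u. \<Sum>j\<in>block s i - L. e j)"
        by (simp only: spl sum.distrib)
      moreover have "(\<Sum>i<u. \<Sum>j\<in>block s i. e j) =
        (\<Sum>i<u. \<Sum>j\<in>C i. e j) + (\<Sum>i<u. \<Sum>j\<in>block s i - C i. e j)"
        by (simp only: spl' sum.distrib)
      ultimately show ?thesis using le by linarith
    qed
    also have "\<dots> \<le> (norm_on {..<u * s} (\<lambda>j. x j - v j))\<^sup>2"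
      unfolding norm_on_sq sum_blocks[OF s]
    proof (rule sum_mono)
      fix i
      have "(\<Sum>j\<in>block s i - C i. e j) = (\<Sum>j\<in>block s i - C i. (cmod (x j - v j))\<^sup>2)"
        by (intro sum.cong) (auto simp: C_def e_def)
      also have "\<dots> \<le> (\<Sum>j\<in>block s i. (cmod (x j - v j))\<^sup>2)"
        using finb by (intro sum_mono2) auto
      finally show "(\<Sum>j\<in>block s i - C i. e j) \<le> (\<Sum>j\<in>block s i. (cmod (x j - v j))\<^sup>2)" .
    qed
    finally show ?thesis
      by (rule power2_le_imp_le) (simp add: norm_on_def)
  qed
qed

end

theory Submission
  imports Defs
begin

text \<open>
  Suppose that an active user \<open>i\<close> is missed although the energies are preserved up to \<open>\<epsilon>\<close>, and let
  \<open>E\<close> be the energy of \<open>h + z\<close> on the path support of \<open>i\<close>. Either the block of \<open>i\<close> is selected,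
  and then \<open>E \<le> \<xi> + \<epsilon>\<close>; or the block of an inactive user is selected instead, so that
  \<open>ks\<close> noise entries of that block have total energy at least \<open>E - 2 \<epsilon>\<close>. If moreover
  \<open>E > 4 \<epsilon>\<close>, one of them satisfies \<open>E \<le> 2 ks |z_j|\<^sup>2\<close>.
  With \<open>v\<close> the noise variance, \<open>|z_j|\<^sup>2\<close> is exponential with mean \<open>v\<close> and independent of \<open>E\<close>,
  so for fixed \<open>j\<close> the last event has the mean of \<open>exp (- E / (2 ks v))\<close> as probability. This factorises over
  the path support, and each factor is at most \<open>2 ks v\<close> because a standard complex Gaussian has
  density at most \<open>1 / \<pi>\<close>. A union bound over the \<open>s (u - ku)\<close> entries of inactive blocks
  gives the last term.

  The failure probability in the bound is not conditional on \<open>i\<close> being active. This is harmless: a cyclic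
  shift by one block multiplies the rows of \<open>A\<close> by phases, hence commutes with \<open>A\<^sup>H A\<close>, and
  preserves the law of all the data. So every user is active with the same probability
  given failure, and failure is independent of the event that \<open>i\<close> is active.
\<close>

subsection \<open>Complex Gaussian variables\<close>

text \<open>The exponents add up, and the normalisations multiply to \<open>1 / (pi * v)\<close>.
  The means \<open>p\<close> and \<open>q\<close> are kept general because a Gaussian centred away
  from the origin is compared with the standard one later.\<close>

lemma normal_density_product:
  assumes "0 < v"
  shows "normal_density p (sqrt (v / 2)) a * normal_density q (sqrt (v / 2)) b =
    exp (- ((a - p)\<^sup>2 + (b - q)\<^sup>2) / v) / (pi * v)"
proof -
  have "sqrt (2 * pi * (sqrt (v / 2))\<^sup>2) = sqrt (pi * v)"
    using assms by simp
  moreover have "exp (- (a - p)\<^sup>2 / v) * exp (- (b - q)\<^sup>2 / v) = exp (- ((a - p)\<^sup>2 + (b - q)\<^sup>2) / v)"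
    by (simp add: exp_add[symmetric] add_divide_distrib diff_divide_distrib)
  ultimately show ?thesis
    using assms by (simp add: normal_density_def field_simps flip: real_sqrt_mult)
qed

lemma measurable_Complex [measurable (raw)]:
  assumes [measurable]: "f \<in> borel_measurable M" "g \<in> borel_measurable M"
  shows "(\<lambda>x. Complex (f x) (g x)) \<in> borel_measurable M"
  unfolding Complex_eq by measurable

lemma measurable_Complex_pair [measurable]:
  "(\<lambda>p. Complex (fst p) (snd p)) \<in> borel_measurable borel"
  unfolding borel_prod[symmetric] by measurable

text \<open>On \<open>real \<times> real\<close> the norm is Euclidean, so the product of the two
  normal densities is a function of \<open>norm p\<close> alone. This radial form turns the tail of
  the Gaussian into areas of annuli.\<close>

lemma
  assumes "0 < v"
  shows prob_space_complex_normal: "prob_space (complex_normal v)"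
    and sets_complex_normal [measurable_cong]: "sets (complex_normal v) = sets borel"
    and nn_integral_complex_normal: "f \<in> borel_measurable borel \<Longrightarrow>
      (\<integral>\<^sup>+x. f x \<partial>complex_normal v) =
      (\<integral>\<^sup>+p. ennreal (exp (- (norm p)\<^sup>2 / v) / (pi * v)) * f (Complex (fst p) (snd p))
        \<partial>(lborel :: (real \<times> real) measure))"
proof -
  let ?D = "density lborel (normal_density 0 (sqrt (v / 2)))"
  have ps: "prob_space ?D" using assms by (intro prob_space_normal_density) simp
  interpret D: pair_prob_space ?D ?D
    using ps by (simp add: pair_prob_space_def pair_sigma_finite_def prob_space_imp_sigma_finite)
  show "prob_space (complex_normal v)"
    unfolding complex_normal_def by (intro D.prob_space_distr) measurable
  show "sets (complex_normal v) = sets borel"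
    by (simp add: complex_normal_def)
  assume [measurable]: "f \<in> borel_measurable borel"
  have "?D \<Otimes>\<^sub>M ?D = density (lborel \<Otimes>\<^sub>M lborel)
     (\<lambda>(x, y). ennreal (normal_density 0 (sqrt (v / 2)) x) * ennreal (normal_density 0 (sqrt (v / 2)) y))"
    by (rule pair_measure_density) (auto simp: prob_space_imp_sigma_finite ps lborel.sigma_finite_measure_axioms)
  also have "\<dots> = density lborel (\<lambda>p. ennreal (exp (- (norm p)\<^sup>2 / v) / (pi * v)))"
    by (simp add: split_beta' lborel_prod normal_density_product[OF assms, of 0 _ 0, simplified]
      norm_prod_def flip: ennreal_mult')
  finally show "(\<integral>\<^sup>+x. f x \<partial>complex_normal v) =
      (\<integral>\<^sup>+p. ennreal (exp (- (norm p)\<^sup>2 / v) / (pi * v)) * f (Complex (fst p) (snd p))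
        \<partial>(lborel :: (real \<times> real) measure))"
    unfolding complex_normal_def
    using measurable_Complex_pair by (simp add: nn_integral_distr nn_integral_density split_beta')
qed

text \<open>The substitution \<open>y = x + a\<close> pulls out \<open>exp (- a)\<close> and leaves
  a Gamma integral. The case \<open>k = 0\<close> writes a Gaussian factor as an integral over
  levels \<open>y\<close>; the case \<open>k = 1\<close> integrates the areas of annuli.\<close>

lemma nn_integral_exp_tail:
  "(\<integral>\<^sup>+y. ennreal (exp (- y) * (y - a) ^ k) * indicator {a..} y \<partial>lborel) = ennreal (fact k * exp (- a))"
proof -
  have "(\<integral>\<^sup>+y. ennreal (exp (- y) * (y - a) ^ k) * indicator {a..} y \<partial>lborel) =
     (\<integral>\<^sup>+x. ennreal (exp (- a)) * (ennreal (x ^ k * exp (- x)) * indicator {0..} x) \<partial>lborel)"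
    by (subst nn_integral_real_affine[where c=1 and t=a])
      (auto intro!: nn_integral_cong split: split_indicator
        simp: exp_diff exp_minus field_simps simp flip: ennreal_mult')
  also have "\<dots> = ennreal (fact k * exp (- a))"
    by (subst nn_integral_cmult, measurable, subst nn_intergal_power_times_exp_Ici)
      (simp add: mult.commute flip: ennreal_mult')
  finally show ?thesis .
qed

text \<open>A closed disc minus an open one. In terms of squared radii the area is linear, which is
  why the tail of \<open>|x|^2\<close> comes out exactly exponential.\<close>

lemma emeasure_annulus:
  assumes "0 \<le> r" "r \<le> R"
  shows "emeasure lborel {p :: real \<times> real. r \<le> (norm p)\<^sup>2 \<and> (norm p)\<^sup>2 \<le> R} = ennreal (pi * (R - r))"
proof -
  have "{p :: real \<times> real. r \<le> (norm p)\<^sup>2 \<and> (norm p)\<^sup>2 \<le> R} = cball 0 (sqrt R) - ball 0 (sqrt r)"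
  proof -
    have "norm p < sqrt r \<longleftrightarrow> \<not> r \<le> (norm p)\<^sup>2" "norm p \<le> sqrt R \<longleftrightarrow> (norm p)\<^sup>2 \<le> R" for p :: "real \<times> real"
      using real_le_lsqrt[of R "norm p"] sqrt_le_D[of "norm p"] real_sqrt_le_iff[of r "(norm p)\<^sup>2"]
        real_sqrt_le_iff[of "(norm p)\<^sup>2" R] assms
      by auto
    then show ?thesis by auto
  qed
  also have "emeasure lborel \<dots> = emeasure lborel (cball 0 (sqrt R) :: (real \<times> real) set)
      - emeasure lborel (ball 0 (sqrt r) :: (real \<times> real) set)"
  proof (rule emeasure_Diff)
    show "ball 0 (sqrt r) \<subseteq> (cball 0 (sqrt R) :: (real \<times> real) set)"
      using assms by (intro order.trans[OF ball_subset_cball] subset_cball) simp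
  qed (use emeasure_lborel_ball_finite[of "0 :: real \<times> real" "sqrt r"] in auto)
  also have "\<dots> = ennreal (pi * (R - r))"
    using assms by (simp add: emeasure_cball emeasure_ball eval_unit_ball_vol ennreal_minus right_diff_distrib)
  finally show ?thesis .
qed

text \<open>Layer cake: writing the Gaussian factor as an integral of \<open>exp (- y)\<close> turns the tail
  into an integral of areas of annuli.\<close>

lemma complex_normal_tail:
  assumes v: "0 < v" and t: "0 \<le> t"
  shows "emeasure (complex_normal v) {x. t \<le> (cmod x)\<^sup>2} = ennreal (exp (- t / v))"
proof -
  have [measurable]: "{x :: complex. t \<le> (cmod x)\<^sup>2} \<in> sets borel" by measurable
  let ?N = "\<lambda>p :: real \<times> real. (norm p)\<^sup>2"
  have E: "(\<integral>\<^sup>+y. ennreal (exp (- y)) * indicator {q / v..} y \<partial>lborel) = ennreal (exp (- q / v))"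
    for q
    using nn_integral_exp_tail[of "q / v" 0] by simp
  have "emeasure (complex_normal v) {x. t \<le> (cmod x)\<^sup>2} =
     (\<integral>\<^sup>+x. indicator {x. t \<le> (cmod x)\<^sup>2} x \<partial>complex_normal v)"
    using v by (simp add: sets_complex_normal)
  also have "\<dots> = (\<integral>\<^sup>+p. ennreal (exp (- ?N p / v) / (pi * v)) * indicator {p. t \<le> ?N p} p \<partial>lborel)"
    using v by (subst nn_integral_complex_normal)
      (auto intro!: nn_integral_cong simp: cmod_def norm_prod_def split: split_indicator)
  also have "\<dots> = (\<integral>\<^sup>+p. (\<integral>\<^sup>+y. ennreal (exp (- y) / (pi * v)) * indicator {p. t \<le> ?N p} p
      * indicator {y. ?N p / v \<le> y} y \<partial>lborel) \<partial>lborel)"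
  proof (rule nn_integral_cong)
    fix p
    have "(\<integral>\<^sup>+y. ennreal (exp (- y) / (pi * v)) * indicator {p. t \<le> ?N p} p * indicator {y. ?N p / v \<le> y} y \<partial>lborel)
      = (\<integral>\<^sup>+y. (ennreal (1 / (pi * v)) * indicator {p. t \<le> ?N p} p) *
          (ennreal (exp (- y)) * indicator {?N p / v..} y) \<partial>lborel)"
      using v by (intro nn_integral_cong) (auto split: split_indicator simp flip: ennreal_mult')
    also have "\<dots> = (ennreal (1 / (pi * v)) * indicator {p. t \<le> ?N p} p) * ennreal (exp (- ?N p / v))"
      by (subst nn_integral_cmult, measurable, subst E) simp
    also have "\<dots> = ennreal (exp (- ?N p / v) / (pi * v)) * indicator {p. t \<le> ?N p} p"
      using v by (auto split: split_indicator simp flip: ennreal_mult')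
    finally show "ennreal (exp (- ?N p / v) / (pi * v)) * indicator {p. t \<le> ?N p} p = (\<integral>\<^sup>+y. ennreal (exp (- y) / (pi * v)) * indicator {p. t \<le> ?N p} p
      * indicator {y. ?N p / v \<le> y} y \<partial>lborel)" by simp
  qed
  also have "\<dots> = (\<integral>\<^sup>+y. (\<integral>\<^sup>+p. ennreal (exp (- y) / (pi * v)) * indicator {p. t \<le> ?N p} p
      * indicator {y. ?N p / v \<le> y} y \<partial>lborel) \<partial>lborel)"
    by (rule lborel_pair.Fubini') measurable
  \<comment> \<open>For fixed \<open>y\<close> the point \<open>p\<close> ranges over
    \<open>t \<le> ?N p \<le> v * y\<close>. This annulus has area \<open>pi * (v * y - t)\<close>,
    and division by \<open>pi * v\<close> leaves \<open>y - t / v\<close>; it is empty for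
    \<open>y < t / v\<close>.\<close>
  also have "\<dots> = (\<integral>\<^sup>+y. ennreal (exp (- y) * (y - t / v)) * indicator {t / v..} y \<partial>lborel)"
  proof (rule nn_integral_cong)
    fix y :: real
    have "(\<integral>\<^sup>+p. ennreal (exp (- y) / (pi * v)) * indicator {p. t \<le> ?N p} p
      * indicator {y. ?N p / v \<le> y} y \<partial>lborel) =
      (\<integral>\<^sup>+p. ennreal (exp (- y) / (pi * v)) * indicator {p. t \<le> ?N p \<and> ?N p \<le> v * y} p \<partial>lborel)"
      using v by (intro nn_integral_cong) (auto split: split_indicator simp: field_simps)
    also have "\<dots> = ennreal (exp (- y) / (pi * v)) * emeasure lborel {p. t \<le> ?N p \<and> ?N p \<le> v * y}"
      by (rule nn_integral_cmult_indicator) measurable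
    also have "\<dots> = ennreal (exp (- y) * (y - t / v)) * indicator {t / v..} y"
    proof (cases "t \<le> v * y")
      case True
      then show ?thesis
        using v t by (subst emeasure_annulus) (auto simp: field_simps simp flip: ennreal_mult')
    next
      case False
      then have "{p. t \<le> ?N p \<and> ?N p \<le> v * y} = {}" by auto
      moreover have "\<not> t / v \<le> y" using False v by (simp add: field_simps)
      ultimately show ?thesis by (simp only: emeasure_empty) simp
    qed
    finally show "(\<integral>\<^sup>+p. ennreal (exp (- y) / (pi * v)) * indicator {p. t \<le> ?N p} p
      * indicator {y. ?N p / v \<le> y} y \<partial>lborel) = ennreal (exp (- y) * (y - t / v)) * indicator {t / v..} y" .
  qed
  also have "\<dots> = ennreal (exp (- t / v))"
    using nn_integral_exp_tail[of "t / v" 1] by simp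
  finally show ?thesis .
qed

text \<open>The density of the standard complex Gaussian is at most \<open>1 / pi\<close>, and
  \<open>exp (- |x + b|^2 / c) / pi\<close> is \<open>c\<close> times the density of a complex
  Gaussian of variance \<open>c\<close> centred at \<open>- b\<close>, whose total mass is one. The
  bound is uniform in \<open>b\<close>, so it survives conditioning on the noise.\<close>

lemma nn_integral_complex_normal_exp_le:
  assumes "0 < c"
  shows "(\<integral>\<^sup>+x. ennreal (exp (- (cmod (x + b))\<^sup>2 / c)) \<partial>complex_normal 1) \<le> ennreal c"
proof -
  let ?d = "\<lambda>p. normal_density p (sqrt (c / 2))"
  have "(\<integral>\<^sup>+x. ennreal (exp (- (cmod (x + b))\<^sup>2 / c)) \<partial>complex_normal 1) \<le>
    (\<integral>\<^sup>+p. ennreal c * (ennreal (?d (- Re b) (fst p)) * ennreal (?d (- Im b) (snd p))) \<partial>lborel)"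
  proof (subst nn_integral_complex_normal, simp, measurable, rule nn_integral_mono)
    fix p :: "real \<times> real"
    have "exp (- (norm p)\<^sup>2 / 1) \<le> 1" by simp
    then have "exp (- (norm p)\<^sup>2 / 1) / (pi * 1) * exp (- (cmod (Complex (fst p) (snd p) + b))\<^sup>2 / c)
       \<le> 1 / (pi * 1) * exp (- (cmod (Complex (fst p) (snd p) + b))\<^sup>2 / c)"
      by (intro mult_right_mono divide_right_mono) auto
    also have "\<dots> = c * (?d (- Re b) (fst p) * ?d (- Im b) (snd p))"
      using assms by (simp add: normal_density_product cmod_def)
    finally show "ennreal (exp (- (norm p)\<^sup>2 / 1) / (pi * 1)) *
         ennreal (exp (- (cmod (Complex (fst p) (snd p) + b))\<^sup>2 / c))
         \<le> ennreal c * (ennreal (?d (- Re b) (fst p)) * ennreal (?d (- Im b) (snd p)))"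
      using assms by (simp flip: ennreal_mult')
  qed
  also have "\<dots> = ennreal c * ((\<integral>\<^sup>+x. ennreal (?d (- Re b) x) \<partial>lborel) * (\<integral>\<^sup>+x. ennreal (?d (- Im b) x) \<partial>lborel))"
    by (simp add: nn_integral_cmult lborel_prod[symmetric] lborel.nn_integral_fst[symmetric] nn_integral_multc)
  also have "\<dots> = ennreal c"
    using assms by (simp add: nn_integral_eq_integral)
  finally show ?thesis .
qed

text \<open>Given all variables except \<open>z j\<close>, the energy on \<open>\<omega>\<close> is
  a constant \<open>E\<close> because \<open>j \<notin> \<omega>\<close>, and the exponential tail
  of \<open>|z j|^2\<close> gives probability \<open>exp (- E / (\<kappa> * v))\<close>. Averaged
  over \<open>g\<close> for fixed noise, this factorises over \<open>\<omega>\<close> with each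
  factor at most \<open>\<kappa> * v\<close>.\<close>

lemma sum_energy_le_noise:
  assumes v: "0 < v" and \<kappa>: "0 < \<kappa>" and I: "\<omega> \<subseteq> {..<n}" "j < n" "j \<notin> \<omega>"
  defines "P \<equiv> complex_normal_vec n 1 \<Otimes>\<^sub>M complex_normal_vec n v"
  shows "emeasure P {x\<in>space P. (\<Sum>l\<in>\<omega>. (cmod (fst x l + snd x l))\<^sup>2) \<le> \<kappa> * (cmod (snd x j))\<^sup>2}
    \<le> ennreal ((\<kappa> * v) ^ card \<omega>)"
proof -
  \<comment> \<open>The noise coordinate \<open>j\<close> is split off, so that it can be integrated
    first with the others held fixed.\<close>
  define J where "J = {..<n} - {j}"
  let ?E = "\<lambda>g z :: nat \<Rightarrow> complex. \<Sum>l\<in>\<omega>. (cmod (g l + z l))\<^sup>2"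
  have J: "insert j J = {..<n}" "finite J" "j \<notin> J" using I by (auto simp: J_def)
  have fin: "finite \<omega>" using I(1) finite_subset by blast
  interpret N: product_prob_space "\<lambda>_. complex_normal v" "{..<n}"
    by (intro product_prob_spaceI prob_space_complex_normal v)
  interpret G: product_prob_space "\<lambda>_. complex_normal 1" "{..<n}"
    by (intro product_prob_spaceI prob_space_complex_normal) simp
  interpret NI: prob_space "PiM J (\<lambda>_. complex_normal v)" by (intro prob_space_PiM prob_space_complex_normal v)
  interpret GN: pair_sigma_finite "PiM J (\<lambda>_. complex_normal v)" "PiM {..<n} (\<lambda>_. complex_normal 1)" ..
  note [measurable_cong] = sets_complex_normal[OF v] sets_complex_normal[OF zero_less_one]
  have P: "P = PiM {..<n} (\<lambda>_. complex_normal 1) \<Otimes>\<^sub>M PiM {..<n} (\<lambda>_. complex_normal v)"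
    by (simp add: P_def complex_normal_vec_def)
  have sub: "l \<in> \<omega> \<Longrightarrow> l \<in> {..<n}" "l \<in> \<omega> \<Longrightarrow> l \<in> J" for l using I by (auto simp: J_def)
  have jI: "j \<in> {..<n}" using I by simp
  have [measurable]: "(\<lambda>x. ?E (fst x) (snd x)) \<in> borel_measurable P"
    using sub(1) unfolding P by measurable
  have EJ: "(\<lambda>(z, g). ennreal (exp (- ?E g z / (\<kappa> * v)))) \<in>
      borel_measurable (PiM J (\<lambda>_. complex_normal v) \<Otimes>\<^sub>M PiM {..<n} (\<lambda>_. complex_normal 1))"
    using sub unfolding split_beta' by measurable
  have [measurable]: "(\<lambda>x. snd x j) \<in> borel_measurable P"
    using jI unfolding P by measurable
  define A where "A = {x\<in>space P. ?E (fst x) (snd x) \<le> \<kappa> * (cmod (snd x j))\<^sup>2}"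
  have A [measurable]: "A \<in> sets P" unfolding A_def by measurable
  have "emeasure P A = (\<integral>\<^sup>+g. \<integral>\<^sup>+z. indicator A (g, z) \<partial>PiM {..<n} (\<lambda>_. complex_normal v) \<partial>PiM {..<n} (\<lambda>_. complex_normal 1))"
    using A unfolding P by (subst N.P.nn_integral_fst) auto
  also have "\<dots> \<le> (\<integral>\<^sup>+g. \<integral>\<^sup>+z. ennreal (exp (- ?E g z / (\<kappa> * v))) \<partial>PiM J (\<lambda>_. complex_normal v) \<partial>PiM {..<n} (\<lambda>_. complex_normal 1))"
  proof (rule nn_integral_mono)
    fix g assume g: "g \<in> space (PiM {..<n} (\<lambda>_. complex_normal 1))"
    have "(\<integral>\<^sup>+z. indicator A (g, z) \<partial>PiM {..<n} (\<lambda>_. complex_normal v)) =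
      (\<integral>\<^sup>+z. \<integral>\<^sup>+x. indicator A (g, z(j := x)) \<partial>complex_normal v \<partial>PiM J (\<lambda>_. complex_normal v))"
      using g A unfolding P
      by (intro N.product_nn_integral_insert[OF J(2,3), unfolded J(1)]) auto
    also have "\<dots> \<le> (\<integral>\<^sup>+z. ennreal (exp (- ?E g z / (\<kappa> * v))) \<partial>PiM J (\<lambda>_. complex_normal v))"
    proof (rule nn_integral_mono)
      fix z
      have "?E g (z(j := x)) = ?E g z" for x
        using I by (intro sum.cong) auto
      then have "(\<integral>\<^sup>+x. indicator A (g, z(j := x)) \<partial>complex_normal v) \<le>
        (\<integral>\<^sup>+x. indicator {x. ?E g z / \<kappa> \<le> (cmod x)\<^sup>2} x \<partial>complex_normal v)"
        using \<kappa> by (intro nn_integral_mono) (auto simp: A_def field_simps split: split_indicator)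
      also have "\<dots> = emeasure (complex_normal v) {x. ?E g z / \<kappa> \<le> (cmod x)\<^sup>2}"
        by (rule nn_integral_indicator) measurable
      also have "\<dots> = ennreal (exp (- (?E g z / \<kappa>) / v))"
        using \<kappa> by (intro complex_normal_tail v) (auto intro!: divide_nonneg_pos sum_nonneg)
      finally show "(\<integral>\<^sup>+x. indicator A (g, z(j := x)) \<partial>complex_normal v) \<le> ennreal (exp (- ?E g z / (\<kappa> * v)))"
        by simp
    qed
    finally show "(\<integral>\<^sup>+z. indicator A (g, z) \<partial>PiM {..<n} (\<lambda>_. complex_normal v)) \<le>
       (\<integral>\<^sup>+z. ennreal (exp (- ?E g z / (\<kappa> * v))) \<partial>PiM J (\<lambda>_. complex_normal v))" .
  qed
  \<comment> \<open>The noise off \<open>j\<close> moves to the outer integral. With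
    \<open>z\<close> fixed, the summands of the energy depend on distinct independent coordinates of
    \<open>g\<close>.\<close>
  also have "\<dots> = (\<integral>\<^sup>+z. \<integral>\<^sup>+g. ennreal (exp (- ?E g z / (\<kappa> * v))) \<partial>PiM {..<n} (\<lambda>_. complex_normal 1) \<partial>PiM J (\<lambda>_. complex_normal v))"
    by (rule GN.Fubini'[OF EJ])
  also have "\<dots> \<le> (\<integral>\<^sup>+z. ennreal ((\<kappa> * v) ^ card \<omega>) \<partial>PiM J (\<lambda>_. complex_normal v))"
  proof (rule nn_integral_mono)
    fix z
    \<comment> \<open>The factor one off \<open>\<omega>\<close> extends the product to all
      coordinates, as required to integrate against the full product measure; these factors
      integrate to one.\<close>
    let ?f = "\<lambda>l x. if l \<in> \<omega> then ennreal (exp (- (cmod (x + z l))\<^sup>2 / (\<kappa> * v))) else 1"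
    have split: "(\<Prod>l<n. if l \<in> \<omega> then F l else 1) = (\<Prod>l\<in>\<omega>. F l)" for F :: "nat \<Rightarrow> ennreal"
      using I(1) by (simp add: prod.If_cases Int_absorb1)
    have "(\<integral>\<^sup>+g. ennreal (exp (- ?E g z / (\<kappa> * v))) \<partial>PiM {..<n} (\<lambda>_. complex_normal 1)) =
      (\<integral>\<^sup>+g. (\<Prod>l<n. ?f l (g l)) \<partial>PiM {..<n} (\<lambda>_. complex_normal 1))"
      unfolding split using fin
      by (simp add: prod_ennreal sum_divide_distrib sum_negf[symmetric] exp_sum)
    also have "\<dots> = (\<Prod>l<n. integral\<^sup>N (complex_normal 1) (?f l))"
      by (rule G.product_nn_integral_prod) auto
    also have "\<dots> = (\<Prod>l<n. if l \<in> \<omega> then (\<integral>\<^sup>+x. ennreal (exp (- (cmod (x + z l))\<^sup>2 / (\<kappa> * v))) \<partial>complex_normal 1) else 1)"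
      by (intro prod.cong) (auto simp: G.M.emeasure_space_1)
    also have "\<dots> \<le> (\<Prod>l\<in>\<omega>. ennreal (\<kappa> * v))"
      unfolding split using \<kappa> v
      by (intro prod_mono_ennreal nn_integral_complex_normal_exp_le) auto
    finally show "(\<integral>\<^sup>+g. ennreal (exp (- ?E g z / (\<kappa> * v))) \<partial>PiM {..<n} (\<lambda>_. complex_normal 1)) \<le> ennreal ((\<kappa> * v) ^ card \<omega>)"
      using \<kappa> v by (simp add: ennreal_power)
  qed
  also have "\<dots> = ennreal ((\<kappa> * v) ^ card \<omega>)"
    by (simp add: NI.emeasure_space_1)
  finally show ?thesis by (simp add: A_def)
qed

subsection \<open>Cyclic shift by one block\<close>

definition next_user :: "nat \<Rightarrow> nat \<Rightarrow> nat"
  where "next_user u i = (i + 1) mod u"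

text \<open>Quotient and remainder keep the block number and the position in the block apart. For
  \<open>j < u * s\<close> the value is \<open>j + s\<close> modulo \<open>u * s\<close>, the form
  in which the shift acts on Fourier phases.\<close>

definition block_shift :: "nat \<Rightarrow> nat \<Rightarrow> nat \<Rightarrow> nat"
  where "block_shift u s j = next_user u (j div s) * s + j mod s"

lemma bij_betw_next_user: "bij_betw (next_user u) {..<u} {..<u}"
proof -
  have "inj_on (next_user u) {..<u}"
    by (auto simp: inj_on_def next_user_def mod_Suc split: if_splits)
  moreover have "next_user u ` {..<u} \<subseteq> {..<u}"
    by (auto simp: next_user_def)
  ultimately show ?thesis
    by (simp add: bij_betw_def endo_inj_surj)
qed

lemma block_shift_div: "0 < s \<Longrightarrow> block_shift u s j div s = next_user u (j div s)"
  and block_shift_mod: "block_shift u s j mod s = j mod s"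
  by (simp_all add: block_shift_def)

lemma block_shift_less:
  assumes "j < u * s" shows "block_shift u s j < u * s"
proof -
  have "0 < s" "0 < u" using assms by (auto intro: Nat.gr0I)
  then have "j mod s < s" "next_user u (j div s) + 1 \<le> u"
    by (auto simp: next_user_def Suc_le_eq)
  then have "(next_user u (j div s) + 1) * s \<le> u * s" by (intro mult_right_mono) auto
  with \<open>j mod s < s\<close> show ?thesis by (simp add: block_shift_def)
qed

lemma div_less_users: "j < u * s \<Longrightarrow> j div s < u" for j :: nat
  by (simp add: less_mult_imp_div_less)

lemma bij_betw_block_shift: "bij_betw (block_shift u s) {..<u * s} {..<u * s}"
proof -
  have "inj_on (block_shift u s) {..<u * s}"
  proof (rule inj_onI)
    fix j l assume jl: "j \<in> {..<u * s}" "l \<in> {..<u * s}" "block_shift u s j = block_shift u s l"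
    then have s: "0 < s" by (auto intro: Nat.gr0I)
    have "next_user u (j div s) = next_user u (l div s)" "j mod s = l mod s"
      using block_shift_div[OF s, of u j] block_shift_div[OF s, of u l] block_shift_mod[of u s j] block_shift_mod[of u s l] jl(3)
      by simp_all
    moreover have "j div s = l div s"
      using bij_betw_next_user[of u] jl(1,2) calculation(1) div_less_users[of _ u s]
      by (auto simp: bij_betw_def inj_on_def)
    ultimately show "j = l" by (metis div_mult_mod_eq)
  qed
  moreover have "block_shift u s ` {..<u * s} \<subseteq> {..<u * s}"
    using block_shift_less by auto
  ultimately show ?thesis
    by (simp add: bij_betw_def endo_inj_surj)
qed

lemma block_shift_cong: "block_shift u s j mod (u * s) = (j + s) mod (u * s)" if "j < u * s"
proof -
  have s: "0 < s" using that by (auto intro: Nat.gr0I)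
  have "(j + s) mod (s * u) = s * ((j + s) div s mod u) + (j + s) mod s"
    by (rule mod_mult2_eq)
  then show ?thesis
    using block_shift_less[OF that] s by (simp add: block_shift_def next_user_def mult.commute)
qed

lemma block_shift_in_block_iff:
  assumes "j < u * s" "i < u"
  shows "block_shift u s j \<in> block s (next_user u i) \<longleftrightarrow> j \<in> block s i"
proof -
  have s: "0 < s" using assms by (auto intro: Nat.gr0I)
  show ?thesis
    using bij_betw_next_user[of u] assms div_less_users[of j u s]
    by (auto simp: in_block_iff[OF s] block_shift_div[OF s] bij_betw_def inj_on_def)
qed

section \<open>Shift invariance of the Fourier kernel\<close>

lemma fourier_periodic:
  assumes "0 < n" "a mod n = b mod n"
  shows "fourier n k a = fourier n k b"
proof -
  have "fourier n k l = fourier n k (l mod n)" for l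
  proof -
    have l: "of_nat l = (of_nat (l div n) * of_nat n + of_nat (l mod n) :: complex)"
      by (metis div_mult_mod_eq of_nat_add of_nat_mult)
    \<comment> \<open>The multiple of \<open>n\<close> contained in \<open>l\<close> changes the
      exponent by an integer multiple of \<open>2 * pi * \<i>\<close>.\<close>
    have E: "- 2 * of_real pi * \<i> * of_nat k * of_nat l / of_nat n =
      - 2 * of_real pi * \<i> * of_nat k * of_nat (l mod n) / of_nat n
      + complex_of_real (2 * of_int (- int (k * (l div n))) * pi) * \<i>"
      using assms(1) by (simp add: l field_simps)
    then show ?thesis
      unfolding fourier_def by (simp only: E exp_add exp_integer_2pi[OF Ints_of_int] mult_1_right)
  qed
  then show ?thesis using assms(2) by metis
qed

text \<open>Translating the column index by \<open>s\<close> multiplies each entry of row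
  \<open>k\<close> by a phase \<open>c\<close> that depends on \<open>k\<close> but not on the
  column. In the product of a conjugated entry with another one of the same row, the phases
  cancel.\<close>

lemma meas_matrix_shift:
  assumes "j < u * s" "l < u * s"
  shows "cnj (meas_matrix (u * s) m k (block_shift u s j)) * meas_matrix (u * s) m k (block_shift u s l)
    = cnj (meas_matrix (u * s) m k j) * meas_matrix (u * s) m k l"
proof -
  define c where "c = exp (- 2 * of_real pi * \<i> * of_nat k * of_nat s / of_nat (u * s))"
  have n: "0 < u * s" using assms by linarith
  have "fourier (u * s) k (block_shift u s j) = fourier (u * s) k j * c" if "j < u * s" for j
  proof -
    have "fourier (u * s) k (block_shift u s j) = fourier (u * s) k (j + s)"
      using that by (intro fourier_periodic n block_shift_cong)
    then show ?thesis
      by (simp add: fourier_def c_def exp_add[symmetric] ring_distribs add_divide_distrib diff_divide_distrib)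
  qed
  moreover have "cnj c * c = 1"
  proof -
    have "c = exp (\<i> * complex_of_real (- 2 * pi * real k * real s / real (u * s)))"
      by (simp add: c_def mult_ac)
    then have "cmod c = 1" by (simp only: norm_exp_i_times)
    then show ?thesis by (simp add: complex_norm_square[symmetric] mult.commute[of "cnj c"])
  qed
  ultimately show ?thesis
    using assms by (simp add: meas_matrix_def mult_ac)
qed

text \<open>The kernel of \<open>A^H A\<close> is a sum over \<open>k \<in> B\<close> of the
  products in \<open>meas_matrix_shift\<close>, so it commutes with the shift for each fixed row set
  \<open>B\<close>. Reindexing the inner sum along the bijection \<open>block_shift\<close> makes
  this visible.\<close>

lemma linear_estimate_shift:
  assumes h: "\<And>l. l < u * s \<Longrightarrow> h' l = h (block_shift u s l)"
    and z: "\<And>l. l < u * s \<Longrightarrow> z' l = z (block_shift u s l)" and j: "j < u * s"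
  shows "linear_estimate (u * s) m h' z' B j = linear_estimate (u * s) m h z B (block_shift u s j)"
proof -
  let ?K = "meas_matrix (u * s) m"
  have "linear_estimate (u * s) m h z B (block_shift u s j) =
    (\<Sum>k\<in>B. cnj (?K k (block_shift u s j)) * (\<Sum>l<u * s. ?K k (block_shift u s l) * (h (block_shift u s l) + z (block_shift u s l))))"
    unfolding linear_estimate_def adjoint_apply_def measurement_def
    by (subst sum.reindex_bij_betw[OF bij_betw_block_shift, symmetric]) (rule refl)
  also have "\<dots> = (\<Sum>k\<in>B. cnj (?K k j) * (\<Sum>l<u * s. ?K k l * (h' l + z' l)))"
    using meas_matrix_shift[OF j] h z
    by (auto simp: sum_distrib_left mult.assoc[symmetric] intro!: sum.cong)
  finally show ?thesis
    by (simp add: linear_estimate_def adjoint_apply_def measurement_def)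
qed

section \<open>Shift invariance of energy preservation\<close>

lemma finite_Omega: "finite (Omega s ks i)"
  by (rule finite_subset[of _ "Pow (block s i)"]) (auto simp: Omega_def block_def)

lemma Omega_nonempty: "ks \<le> s \<Longrightarrow> Omega s ks i \<noteq> {}"
  using obtain_subset_with_card_n[of ks "block s i"] by (auto simp: Omega_def block_def)

text \<open>The maximum is over a finite family that is nonempty because \<open>0 < u\<close> and
  \<open>ks \<le> s\<close>, so bounding it means bounding every member.\<close>

lemma energy_preserving_iff:
  assumes "0 < u" "ks \<le> s"
  shows "energy_preserving u s ks m \<epsilon> h z B \<longleftrightarrow>
    (\<forall>i<u. \<forall>\<omega>\<in>Omega s ks i. \<bar>(\<Sum>j\<in>\<omega>. (cmod (h j + z j))\<^sup>2)
         - (\<Sum>j\<in>\<omega>. (cmod (linear_estimate (u * s) m h z B j))\<^sup>2)\<bar> \<le> \<epsilon>)"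
  unfolding energy_preserving_def
  using assms Omega_nonempty[OF assms(2)]
  by (subst Max_le_iff) (auto intro!: finite_SigmaI finite_Omega)

lemma Omega_subset: "i < u \<Longrightarrow> \<omega> \<in> Omega s ks i \<Longrightarrow> \<omega> \<subseteq> {..<u * s}"
  using Union_block[where u=u and s=s] by (auto simp: Omega_def)

lemma Omega_shift:
  assumes "i < u"
  shows "Omega s ks (next_user u i) = (`) (block_shift u s) ` Omega s ks i"
proof (intro set_eqI iffI)
  note inj = bij_betw_imp_inj_on[OF bij_betw_block_shift[of u s]]
  have ni: "next_user u i < u" using assms by (simp add: next_user_def)
  fix \<omega>
  show "\<omega> \<in> Omega s ks (next_user u i)" if "\<omega> \<in> (`) (block_shift u s) ` Omega s ks i"
  proof -
    obtain \<omega>' where \<omega>': "\<omega> = block_shift u s ` \<omega>'" "\<omega>' \<in> Omega s ks i" using \<open>\<omega> \<in> (`) (block_shift u s) ` Omega s ks i\<close> by auto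
    note sub = Omega_subset[OF assms \<omega>'(2)]
    have "card \<omega> = card \<omega>'" unfolding \<omega>'(1) by (intro card_image inj_on_subset[OF inj sub])
    then show ?thesis
      using \<omega>' sub block_shift_in_block_iff[OF _ assms] by (auto simp: Omega_def)
  qed
  assume \<omega>: "\<omega> \<in> Omega s ks (next_user u i)"
  \<comment> \<open>The preimage is taken inside \<open>{..<u * s}\<close>, where the shift is a
    bijection; outside this range it need not be injective.\<close>
  let ?\<omega> = "{j\<in>{..<u * s}. block_shift u s j \<in> \<omega>}"
  note sub = Omega_subset[OF ni \<omega>]
  have im: "block_shift u s ` ?\<omega> = \<omega>"
    using sub bij_betw_imp_surj_on[OF bij_betw_block_shift[of u s]] by (auto 4 3)
  have "?\<omega> \<subseteq> {..<u * s}" by auto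
  from card_image[OF inj_on_subset[OF inj this]] have "card ?\<omega> = card \<omega>"
    unfolding im by (rule sym)
  then have "?\<omega> \<in> Omega s ks i"
    using \<omega> block_shift_in_block_iff[OF _ assms, of _ s] by (auto simp: Omega_def)
  with im show "\<omega> \<in> (`) (block_shift u s) ` Omega s ks i" by (intro image_eqI[of _ _ ?\<omega>]) auto
qed

text \<open>The energy discrepancy of the shifted data on \<open>\<omega>\<close> is that of the
  original data on the image of \<open>\<omega>\<close>. These images run over all admissible
  supports of all blocks, since \<open>next_user\<close> permutes the users.\<close>

lemma energy_preserving_shift:
  assumes h: "\<And>l. l < u * s \<Longrightarrow> h' l = h (block_shift u s l)"
    and z: "\<And>l. l < u * s \<Longrightarrow> z' l = z (block_shift u s l)" and us: "0 < u" "ks \<le> s"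
  shows "energy_preserving u s ks m \<epsilon> h' z' B \<longleftrightarrow> energy_preserving u s ks m \<epsilon> h z B"
proof -
  let ?D = "\<lambda>h z \<omega>. \<bar>(\<Sum>j\<in>\<omega>. (cmod (h j + z j))\<^sup>2)
         - (\<Sum>j\<in>\<omega>. (cmod (linear_estimate (u * s) m h z B j))\<^sup>2)\<bar>"
  have D: "?D h z (block_shift u s ` \<omega>) = ?D h' z' \<omega>" if "i < u" "\<omega> \<in> Omega s ks i" for i \<omega>
  proof -
    note sub = Omega_subset[OF that]
    note inj = inj_on_subset[OF bij_betw_imp_inj_on[OF bij_betw_block_shift] sub]
    have "(\<Sum>j\<in>\<omega>. (cmod (h (block_shift u s j) + z (block_shift u s j)))\<^sup>2) = (\<Sum>j\<in>\<omega>. (cmod (h' j + z' j))\<^sup>2)"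
      using sub h z by (intro sum.cong) auto
    moreover have "(\<Sum>j\<in>\<omega>. (cmod (linear_estimate (u * s) m h z B (block_shift u s j)))\<^sup>2) =
      (\<Sum>j\<in>\<omega>. (cmod (linear_estimate (u * s) m h' z' B j))\<^sup>2)"
      using sub by (intro sum.cong) (auto simp: linear_estimate_shift[of u s h' h z' z, OF h z])
    ultimately show ?thesis by (simp add: sum.reindex[OF inj])
  qed
  have "(\<forall>i<u. \<forall>\<omega>\<in>Omega s ks i. ?D h z \<omega> \<le> \<epsilon>) \<longleftrightarrow>
    (\<forall>i\<in>next_user u ` {..<u}. \<forall>\<omega>\<in>Omega s ks i. ?D h z \<omega> \<le> \<epsilon>)"
    by (simp only: bij_betw_imp_surj_on[OF bij_betw_next_user]) auto
  also have "\<dots> \<longleftrightarrow> (\<forall>i<u. \<forall>\<omega>\<in>Omega s ks i. ?D h' z' \<omega> \<le> \<epsilon>)"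
    using D by (auto simp: Omega_shift)
  finally show ?thesis
    unfolding energy_preserving_iff[OF us] by simp
qed

subsection \<open>Missed users\<close>

text \<open>The deterministic core: \<open>y\<close> stands for \<open>h + z\<close>,
  \<open>x\<close> for the linear estimate, \<open>U\<^sub>0\<close> for the active users and
  \<open>S\<close> for the path support of \<open>i\<close>. In the second alternative
  \<open>y j\<close> will be pure noise, because the signal vanishes on inactive blocks.\<close>

lemma missed_user_cases:
  assumes s: "0 < s" and ks: "0 < ks" and i: "i < u" "i \<in> U\<^sub>0" and U0: "U\<^sub>0 \<subseteq> {..<u}" "card U\<^sub>0 = ku"
    and S: "S \<in> Omega s ks i" and L: "hier_threshold u s ku ks x L"
    and missed: "\<not> declared_active s \<xi> x L i" and \<xi>: "0 \<le> \<xi>" and \<epsilon>: "0 < \<epsilon>"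
    and pres: "\<And>i \<omega>. i < u \<Longrightarrow> \<omega> \<in> Omega s ks i \<Longrightarrow>
      \<bar>(\<Sum>j\<in>\<omega>. (cmod (y j))\<^sup>2) - (\<Sum>j\<in>\<omega>. (cmod (x j))\<^sup>2)\<bar> \<le> \<epsilon>"
  shows "(\<Sum>j\<in>S. (cmod (y j))\<^sup>2) \<le> \<xi> + 4 * \<epsilon> \<or>
    (\<exists>j<u * s. j div s \<notin> U\<^sub>0 \<and> (\<Sum>l\<in>S. (cmod (y l))\<^sup>2) \<le> 2 * real ks * (cmod (y j))\<^sup>2)"
proof -
  let ?e = "\<lambda>v \<omega>. \<Sum>j\<in>\<omega>. (cmod (v j))\<^sup>2"
  obtain \<omega> U where \<omega>: "\<And>i. i < u \<Longrightarrow> \<omega> i \<in> Omega s ks i"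
    and \<omega>max: "\<And>i j l. i < u \<Longrightarrow> j \<in> \<omega> i \<Longrightarrow> l \<in> block s i - \<omega> i \<Longrightarrow> cmod (x l) \<le> cmod (x j)"
    and U: "U \<subseteq> {..<u}" "card U = ku"
    and Umax: "\<And>i i'. i \<in> U \<Longrightarrow> i' \<in> {..<u} - U \<Longrightarrow> norm_on (\<omega> i') x \<le> norm_on (\<omega> i) x"
    and LU: "L = (\<Union>i\<in>U. \<omega> i)"
    using L unfolding hier_threshold_def by metis
  \<comment> \<open>The kept set consists of the \<open>ks\<close> largest entries of the block, so
    no other set of that size carries more energy.\<close>
  have best: "?e x S \<le> ?e x (\<omega> i)"
  proof (rule sum_le_sum_largest)
    show "finite (block s i)" by (simp add: block_def)
    show "\<omega> i \<subseteq> block s i" "S \<subseteq> block s i" "card S \<le> card (\<omega> i)"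
      using S \<omega>[OF i(1)] by (simp_all add: Omega_def)
  qed (use \<omega>max[OF i(1)] in \<open>auto simp: power_mono\<close>)
  have eS: "?e y S \<le> ?e x (\<omega> i) + \<epsilon>"
    using pres[OF i(1) S] best by linarith
  show ?thesis
  proof (cases "i \<in> U")
    case True
    have LB: "L \<inter> block s i = \<omega> i"
    proof -
      have "i' = i" if "i' \<in> U" "j \<in> \<omega> i'" "j \<in> block s i" for i' j
      proof -
        have "j \<in> block s i'" using that(1,2) \<omega>[of i'] U(1) by (auto simp: Omega_def)
        then show ?thesis using that(3) by (simp add: in_block_iff[OF s])
      qed
      then show ?thesis using \<omega>[OF i(1)] True unfolding LU by (auto simp: Omega_def)
    qed
    \<comment> \<open>As \<open>ks > 0\<close>, the block of a selected user meets \<open>L\<close>;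
      a selected user can thus be missed only by failing the energy test.\<close>
    have "\<omega> i \<noteq> {}" using \<omega>[OF i(1)] ks by (auto simp: Omega_def)
    then have lt: "norm_on (block s i) (restrict_vec L x) < sqrt \<xi>"
      using missed LB by (simp add: declared_active_def not_le)
    have "?e x (\<omega> i) = (norm_on (block s i) (restrict_vec L x))\<^sup>2"
      unfolding norm_on_sq LB[symmetric]
      by (rule sum.mono_neutral_cong_left) (auto simp: restrict_vec_def block_def)
    also have "\<dots> \<le> \<xi>"
      using power_mono[OF less_imp_le[OF lt], of 2] \<xi> by (simp add: norm_on_def)
    finally show ?thesis using eS \<epsilon> by linarith
  next
    case False
    \<comment> \<open>Both sets have \<open>ku\<close> elements and \<open>i\<close> lies only in
      \<open>U\<^sub>0\<close>, so some selected user is inactive.\<close>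
    have "\<not> U \<subseteq> U\<^sub>0"
      using card_subset_eq[of U\<^sub>0 U] U U0 i False finite_subset[OF U0(1)] by auto
    then obtain i' where i': "i' \<in> U" "i' \<notin> U\<^sub>0" by auto
    then have i'u: "i' < u" using U by auto
    have "norm_on (\<omega> i) x \<le> norm_on (\<omega> i') x" using Umax[OF i'(1)] i False by simp
    then have "?e x (\<omega> i) \<le> ?e x (\<omega> i')"
      using power_mono[of "norm_on (\<omega> i) x" "norm_on (\<omega> i') x" 2] by (simp add: norm_on_sq) (simp add: norm_on_def)
    then have e2: "?e y S \<le> ?e y (\<omega> i') + 2 * \<epsilon>"
      using pres[OF i'u \<omega>[OF i'u]] eS by linarith
    have card: "card (\<omega> i') = ks" and sub: "\<omega> i' \<subseteq> block s i'" using \<omega>[OF i'u] by (auto simp: Omega_def)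
    \<comment> \<open>Some entry carries at least the average of the \<open>ks\<close>
      energies.\<close>
    have "\<exists>j\<in>\<omega> i'. ?e y (\<omega> i') \<le> real ks * (cmod (y j))\<^sup>2"
    proof (rule ccontr)
      assume "\<not> ?thesis"
      then have "(\<Sum>j\<in>\<omega> i'. real ks * (cmod (y j))\<^sup>2) < (\<Sum>j\<in>\<omega> i'. ?e y (\<omega> i'))"
        using card ks card_gt_0_iff[of "\<omega> i'"] by (intro sum_strict_mono) (auto simp: not_le)
      then show False by (simp add: card sum_distrib_left)
    qed
    then obtain j where j: "j \<in> \<omega> i'" "?e y (\<omega> i') \<le> real ks * (cmod (y j))\<^sup>2" by auto
    have "j < u * s" using j(1) Omega_subset[OF i'u \<omega>[OF i'u]] by auto
    moreover have "j div s \<notin> U\<^sub>0" using j(1) sub i'(2) in_block_iff[OF s] by auto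
    \<comment> \<open>If the energy on \<open>S\<close> exceeds \<open>4 * \<epsilon>\<close>, the
      error \<open>2 * \<epsilon>\<close> is less than half of it, so the other half is at most the
      energy on \<open>\<omega> i'\<close>. This is the origin of the constants \<open>4\<close> and
      \<open>2\<close>.\<close>
    moreover have "?e y S \<le> 2 * real ks * (cmod (y j))\<^sup>2" if "\<not> ?e y S \<le> \<xi> + 4 * \<epsilon>"
      using that e2 j(2) \<xi> by simp
    ultimately show ?thesis by blast
  qed
qed

subsection \<open>Invariance of product and uniform measures\<close>

lemma prob_space_uniform_subset:
  assumes "finite X" "k \<le> card X"
  shows "prob_space (uniform_subset X k)"
  unfolding uniform_subset_def
proof (rule prob_space_uniform_count_measure)
  show "finite {I. I \<subseteq> X \<and> card I = k}" using assms(1) by simp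
  show "{I. I \<subseteq> X \<and> card I = k} \<noteq> {}"
    using obtain_subset_with_card_n[OF assms(2)] by blast
qed

lemma space_uniform_subset: "space (uniform_subset X k) = {I. I \<subseteq> X \<and> card I = k}"
  and sets_uniform_subset: "sets (uniform_subset X k) = Pow {I. I \<subseteq> X \<and> card I = k}"
  by (simp_all add: uniform_subset_def space_uniform_count_measure sets_uniform_count_measure)

lemma pred_mem_uniform_subset:
  assumes "f \<in> M \<rightarrow>\<^sub>M uniform_subset X k"
  shows "Measurable.pred M (\<lambda>x. i \<in> f x)"
  by (rule measurable_compose[OF assms]) (auto simp: measurable_def space_uniform_subset sets_uniform_subset)

text \<open>Taking preimages under \<open>t\<close> is inverse to taking images, hence a bijection
  between the \<open>k\<close>-subsets of \<open>Y\<close> and those of \<open>X\<close>, and it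
  transports the uniform measure. The ambient set \<open>D\<close> allows one and the same map
  \<open>F\<close> to serve all blocks at once.\<close>

lemma distr_uniform_subset:
  assumes t: "bij_betw t X Y" and fin: "finite X" and X: "{j\<in>D. t j \<in> Y} = X"
  defines "F \<equiv> \<lambda>A. {j\<in>D. t j \<in> A}"
  shows "F \<in> uniform_subset Y k \<rightarrow>\<^sub>M uniform_subset X k"
    and "distr (uniform_subset Y k) (uniform_subset X k) F = uniform_subset X k"
proof -
  let ?S = "\<lambda>X. {I. I \<subseteq> X \<and> card I = k}"
  have finY: "finite Y" using bij_betw_finite[OF t] fin by simp
  have F: "F A \<subseteq> X" "t ` F A = A" "card (F A) = card A" if AY: "A \<subseteq> Y" for A
  proof -
    show sub: "F A \<subseteq> X" using that X by (auto simp: F_def)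
    show im: "t ` F A = A"
    proof
      show "A \<subseteq> t ` F A"
      proof
        fix a assume a: "a \<in> A"
        then obtain x where "x \<in> X" "a = t x" using AY bij_betw_imp_surj_on[OF t] by blast
        then show "a \<in> t ` F A" using X a by (auto simp: F_def)
      qed
    qed (auto simp: F_def)
    show "card (F A) = card A"
      using card_image[OF inj_on_subset[OF bij_betw_imp_inj_on[OF t] sub]] unfolding im by simp
  qed
  have Fim: "F (t ` A) = A" if "A \<subseteq> X" for A
    using that X bij_betw_imp_inj_on[OF t] bij_betw_imp_surj_on[OF t]
    by (auto simp: F_def inj_on_def)
  have bij: "bij_betw F (?S Y) (?S X)"
  proof (rule bij_betwI[where g="(`) t"])
    show "(`) t \<in> ?S X \<rightarrow> ?S Y"
    proof (intro Pi_I)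
      fix A assume A: "A \<in> ?S X"
      then have "card (t ` A) = card A"
        by (intro card_image inj_on_subset[OF bij_betw_imp_inj_on[OF t]]) auto
      then show "t ` A \<in> ?S Y" using A bij_betw_imp_surj_on[OF t] by auto
    qed
  qed (use F Fim in auto)
  show meas: "F \<in> uniform_subset Y k \<rightarrow>\<^sub>M uniform_subset X k"
    using bij_betwE[OF bij] by (auto simp: measurable_def space_uniform_subset sets_uniform_subset)
  show "distr (uniform_subset Y k) (uniform_subset X k) F = uniform_subset X k"
  proof (rule measure_eqI)
    fix E assume "E \<in> sets (distr (uniform_subset Y k) (uniform_subset X k) F)"
    then have E: "E \<subseteq> ?S X" by (simp add: sets_uniform_subset)
    have "F ` (F -` E \<inter> ?S Y) = E" using E unfolding bij_betw_imp_surj_on[OF bij, symmetric] by auto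
    moreover have "inj_on F (F -` E \<inter> ?S Y)" using bij_betw_imp_inj_on[OF bij] by (rule inj_on_subset) auto
    ultimately have "card (F -` E \<inter> ?S Y) = card E" by (metis card_image)
    moreover have "emeasure (uniform_subset Z k) A = ennreal (real (card A) / real (card (?S Z)))"
      if "finite Z" "A \<subseteq> ?S Z" for Z A
      using that by (simp add: uniform_subset_def emeasure_uniform_count_measure)
    ultimately show "emeasure (distr (uniform_subset Y k) (uniform_subset X k) F) E = emeasure (uniform_subset X k) E"
      using E fin finY bij_betw_same_card[OF bij] meas
      by (simp add: emeasure_distr sets_uniform_subset space_uniform_subset)
  qed simp
qed

text \<open>The map permutes coordinates along \<open>p\<close> and then applies \<open>f\<close> in
  each coordinate. The marginals may differ, as long as \<open>f\<close> carries
  \<open>M (p i)\<close> to \<open>M i\<close>; this covers the path supports, which live on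
  different blocks.\<close>

lemma distr_PiM_permute:
  assumes fin: "finite I" and p: "bij_betw p I I" and M: "\<And>i. i \<in> I \<Longrightarrow> prob_space (M i)"
    and f: "\<And>i. i \<in> I \<Longrightarrow> f \<in> M (p i) \<rightarrow>\<^sub>M M i"
    and inv: "\<And>i. i \<in> I \<Longrightarrow> distr (M (p i)) (M i) f = M i"
  shows "(\<lambda>\<omega>. \<lambda>i\<in>I. f (\<omega> (p i))) \<in> PiM I M \<rightarrow>\<^sub>M PiM I M"
    and "distr (PiM I M) (PiM I M) (\<lambda>\<omega>. \<lambda>i\<in>I. f (\<omega> (p i))) = PiM I M"
proof -
  let ?N = "PiM I (\<lambda>i. M (p i))"
  have pI: "p i \<in> I" if "i \<in> I" for i using bij_betwE[OF p] that by auto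
  have m1: "(\<lambda>\<omega>. \<lambda>i\<in>I. \<omega> (p i)) \<in> PiM I M \<rightarrow>\<^sub>M ?N"
    using pI by (intro measurable_restrict measurable_component_singleton) auto
  have m2: "compose I f \<in> ?N \<rightarrow>\<^sub>M PiM I M"
    unfolding compose_def
    by (intro measurable_restrict) (rule measurable_compose[OF measurable_component_singleton], assumption, rule f)
  have comp: "compose I f \<circ> (\<lambda>\<omega>. \<lambda>i\<in>I. \<omega> (p i)) = (\<lambda>\<omega>. \<lambda>i\<in>I. f (\<omega> (p i)))"
    by (auto simp: compose_def fun_eq_iff)
  show "(\<lambda>\<omega>. \<lambda>i\<in>I. f (\<omega> (p i))) \<in> PiM I M \<rightarrow>\<^sub>M PiM I M"
    using measurable_comp[OF m1 m2] unfolding comp .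
  have "distr (PiM I M) (PiM I M) (\<lambda>\<omega>. \<lambda>i\<in>I. f (\<omega> (p i))) =
    distr (distr (PiM I M) ?N (\<lambda>\<omega>. \<lambda>i\<in>I. \<omega> (p i))) (PiM I M) (compose I f)"
    using distr_distr[OF m2 m1] unfolding comp by simp
  also have "distr (PiM I M) ?N (\<lambda>\<omega>. \<lambda>i\<in>I. \<omega> (p i)) = ?N"
    using p pI M by (intro distr_PiM_reindex) (auto simp: bij_betw_def)
  also have "distr ?N (PiM I M) (compose I f) = PiM I (\<lambda>i. distr (M (p i)) (M i) f)"
    using M f pI by (intro distr_PiM_finite_prob_space' fin) auto
  also have "\<dots> = PiM I M" using inv by (intro PiM_cong) auto
  finally show "distr (PiM I M) (PiM I M) (\<lambda>\<omega>. \<lambda>i\<in>I. f (\<omega> (p i))) = PiM I M" .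
qed

lemma distr_pair_invariant:
  assumes "f \<in> M \<rightarrow>\<^sub>M M" "g \<in> N \<rightarrow>\<^sub>M N" "distr M M f = M" "distr N N g = N" "prob_space N"
  shows "(\<lambda>p. (f (fst p), g (snd p))) \<in> M \<Otimes>\<^sub>M N \<rightarrow>\<^sub>M M \<Otimes>\<^sub>M N"
    and "distr (M \<Otimes>\<^sub>M N) (M \<Otimes>\<^sub>M N) (\<lambda>p. (f (fst p), g (snd p))) = M \<Otimes>\<^sub>M N"
proof -
  show "(\<lambda>p. (f (fst p), g (snd p))) \<in> M \<Otimes>\<^sub>M N \<rightarrow>\<^sub>M M \<Otimes>\<^sub>M N"
    using assms(1,2) by measurable
  show "distr (M \<Otimes>\<^sub>M N) (M \<Otimes>\<^sub>M N) (\<lambda>p. (f (fst p), g (snd p))) = M \<Otimes>\<^sub>M N"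
    using pair_measure_distr[OF assms(1,2)] assms(3,4) prob_space_imp_sigma_finite[OF assms(5)]
    by (simp add: split_beta')
qed

text \<open>Double counting: the indicators of the \<open>A i\<close> sum to \<open>k\<close> on
  \<open>B\<close> and to zero elsewhere.\<close>

lemma (in finite_measure) sum_measure_const_card:
  assumes fin: "finite I" and A: "\<And>i. i \<in> I \<Longrightarrow> A i \<in> sets M" "\<And>i. i \<in> I \<Longrightarrow> A i \<subseteq> B" and B: "B \<in> sets M"
    and card: "\<And>x. x \<in> B \<Longrightarrow> card {i\<in>I. x \<in> A i} = k"
  shows "(\<Sum>i\<in>I. measure M (A i)) = real k * measure M B"
proof -
  have "(\<Sum>i\<in>I. measure M (A i)) = (\<Sum>i\<in>I. \<integral>x. indicator (A i) x \<partial>M)"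
    using A by (intro sum.cong) (auto simp: Int_absorb2 sets.sets_into_space)
  also have "\<dots> = (\<integral>x. (\<Sum>i\<in>I. indicator (A i) x) \<partial>M)"
    using A by (intro Bochner_Integration.integral_sum[symmetric]) (auto simp: integrable_real_indicator emeasure_eq_measure)
  also have "\<dots> = (\<integral>x. real k * indicator B x \<partial>M)"
  proof (intro Bochner_Integration.integral_cong refl)
    fix x
    have "(\<Sum>i\<in>I. indicator (A i) x :: real) = card {i\<in>I. x \<in> A i}"
      using fin by (simp add: indicator_def sum.If_cases Int_def)
    moreover have "{i\<in>I. x \<in> A i} = {}" if "x \<notin> B" using that A(2) by auto
    ultimately show "(\<Sum>i\<in>I. indicator (A i) x :: real) = real k * indicator B x"
      using card[of x] by (cases "x \<in> B") auto
  qed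
  also have "\<dots> = real k * measure M B"
    using B by (simp add: Int_absorb2 sets.sets_into_space)
  finally show ?thesis .
qed

subsection \<open>The joint law of the model\<close>

type_synonym outcome =
  "(nat set \<times> (nat \<Rightarrow> nat set) \<times> (nat \<Rightarrow> complex)) \<times> (nat \<Rightarrow> complex) \<times> nat set"

abbreviation users :: "outcome \<Rightarrow> nat set" where "users x \<equiv> fst (fst x)"
abbreviation supports :: "outcome \<Rightarrow> nat \<Rightarrow> nat set" where "supports x \<equiv> fst (snd (fst x))"
abbreviation signal :: "outcome \<Rightarrow> nat \<Rightarrow> complex" where "signal x \<equiv> snd (snd (fst x))"
abbreviation noise :: "outcome \<Rightarrow> nat \<Rightarrow> complex" where "noise x \<equiv> fst (snd x)"
abbreviation rows :: "outcome \<Rightarrow> nat set" where "rows x \<equiv> snd (snd x)"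

definition path_energy :: "nat \<Rightarrow> outcome \<Rightarrow> real"
  where "path_energy i x = (\<Sum>j\<in>supports x i. (cmod (signal x j + noise x j))\<^sup>2)"

locale access_params =
  fixes u s ku ks m :: nat and \<sigma> :: real
  assumes ku: "0 < ku" "ku < u" and ks: "0 < ks" "ks \<le> s" and m: "0 < m" "m \<le> u * s" and \<sigma>: "0 < \<sigma>"
begin

abbreviation n :: nat where "n \<equiv> u * s"

abbreviation v :: real where "v \<equiv> \<sigma>\<^sup>2 * real m / (real n)\<^sup>2"

definition users_law :: "nat set measure"
  where "users_law = uniform_subset {..<u} ku"

definition supports_law :: "(nat \<Rightarrow> nat set) measure"
  where "supports_law = (\<Pi>\<^sub>M i\<in>{..<u}. uniform_subset (block s i) ks)"

definition gains_law :: "(nat \<Rightarrow> complex) measure"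
  where "gains_law = complex_normal_vec n 1"

definition noise_rows_law :: "((nat \<Rightarrow> complex) \<times> nat set) measure"
  where "noise_rows_law = noise_law n m \<sigma> \<Otimes>\<^sub>M uniform_subset {..<n} m"

definition law :: "outcome measure"
  where "law = signal_law u s ku ks \<Otimes>\<^sub>M noise_rows_law"

text \<open>The law before the entries of \<open>g\<close> outside of the support are set to zero.\<close>

definition base :: "outcome measure"
  where "base = (users_law \<Otimes>\<^sub>M supports_law \<Otimes>\<^sub>M gains_law) \<Otimes>\<^sub>M noise_rows_law"

definition active_part :: "nat set \<times> (nat \<Rightarrow> nat set) \<times> (nat \<Rightarrow> complex) \<Rightarrow>
    nat set \<times> (nat \<Rightarrow> nat set) \<times> (nat \<Rightarrow> complex)"
  where "active_part = (\<lambda>(U, S, g). (U, S,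
    \<lambda>j\<in>{..<n}. if j div s \<in> U \<and> j \<in> S (j div s) then g j else 0))"

definition observe :: "outcome \<Rightarrow> outcome"
  where "observe y = (active_part (fst y), snd y)"

lemma v_pos: "0 < v"
  using \<sigma> m ks ku by simp

lemma prob_space_users_law: "prob_space users_law"
  unfolding users_law_def using ku by (intro prob_space_uniform_subset) auto

lemma prob_space_support: "prob_space (uniform_subset (block s i) ks)"
  using ks by (intro prob_space_uniform_subset) (auto simp: block_def)

lemma prob_space_supports_law: "prob_space supports_law"
  unfolding supports_law_def by (intro prob_space_PiM prob_space_support)

lemma prob_space_gains_law: "prob_space gains_law"
  unfolding gains_law_def complex_normal_vec_def by (intro prob_space_PiM prob_space_complex_normal) simp

lemma prob_space_noise_law: "prob_space (noise_law n m \<sigma>)"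
  unfolding noise_law_def complex_normal_vec_def by (intro prob_space_PiM prob_space_complex_normal v_pos)

lemma prob_space_rows_law: "prob_space (uniform_subset {..<n} m)"
  using m by (intro prob_space_uniform_subset) auto

lemma prob_space_noise_rows_law: "prob_space noise_rows_law"
  unfolding noise_rows_law_def
  by (intro prob_space_pair prob_space_noise_law prob_space_rows_law)

lemma prob_space_base: "prob_space base"
  unfolding base_def
  by (intro prob_space_pair prob_space_users_law prob_space_supports_law prob_space_gains_law prob_space_noise_rows_law)

lemma sets_gains_law [measurable_cong]: "sets gains_law = sets (\<Pi>\<^sub>M j\<in>{..<n}. borel)"
  unfolding gains_law_def complex_normal_vec_def by (intro sets_PiM_cong sets_complex_normal) auto

lemma sets_noise_law [measurable_cong]: "sets (noise_law n m \<sigma>) = sets (\<Pi>\<^sub>M j\<in>{..<n}. borel)"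
  unfolding noise_law_def complex_normal_vec_def by (intro sets_PiM_cong sets_complex_normal v_pos) auto

lemma measurable_active_part:
  "active_part \<in> users_law \<Otimes>\<^sub>M supports_law \<Otimes>\<^sub>M gains_law
    \<rightarrow>\<^sub>M users_law \<Otimes>\<^sub>M supports_law \<Otimes>\<^sub>M (\<Pi>\<^sub>M j\<in>{..<n}. borel)"
proof -
  have [measurable]: "Measurable.pred (users_law \<Otimes>\<^sub>M supports_law \<Otimes>\<^sub>M gains_law) (\<lambda>q. i \<in> fst q)" for i
    unfolding users_law_def by (rule pred_mem_uniform_subset) measurable
  have [measurable]: "Measurable.pred (users_law \<Otimes>\<^sub>M supports_law \<Otimes>\<^sub>M gains_law) (\<lambda>q. j \<in> fst (snd q) (j div s))"
    if "j < n" for j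
    unfolding supports_law_def
    by (rule pred_mem_uniform_subset[where X="block s (j div s)" and k=ks], measurable)
      (use that in \<open>simp add: div_less_users\<close>)
  show ?thesis
    unfolding active_part_def split_beta'
    by (intro measurable_Pair measurable_restrict) measurable
qed

text \<open>Masking acts on the signal component only, so the push-forward can be taken after
  forming the product with noise and rows. Events under \<open>law\<close> thereby become events
  under the product measure \<open>base\<close>, where Fubini applies and the shift acts factor by
  factor.\<close>

lemma law_eq: "law = distr base law observe" and measurable_observe: "observe \<in> base \<rightarrow>\<^sub>M law"
proof -
  let ?R = "users_law \<Otimes>\<^sub>M supports_law \<Otimes>\<^sub>M gains_law"
  let ?T = "users_law \<Otimes>\<^sub>M supports_law \<Otimes>\<^sub>M (\<Pi>\<^sub>M j\<in>{..<n}. borel)"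
  have sig: "signal_law u s ku ks = distr ?R ?T active_part"
    by (simp add: signal_law_def users_law_def supports_law_def gains_law_def active_part_def Let_def)
  \<comment> \<open>\<open>pair_measure_distr\<close> takes a push-forward in both factors; in the
    second one it is along the identity.\<close>
  have sf: "sigma_finite_measure (distr noise_rows_law noise_rows_law (\<lambda>x. x))"
    using prob_space_noise_rows_law by (simp add: distr_id2 prob_space_imp_sigma_finite)
  have sets: "sets law = sets (?T \<Otimes>\<^sub>M noise_rows_law)"
    unfolding law_def sig by (intro sets_pair_measure_cong) auto
  have obs: "observe = (\<lambda>(x, y). (active_part x, y))"
    by (simp add: observe_def fun_eq_iff)
  show "law = distr base law observe"
    using pair_measure_distr[OF measurable_active_part _ sf] sets
    unfolding base_def obs
    by (simp add: law_def sig distr_id2 cong: distr_cong)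
  show "observe \<in> base \<rightarrow>\<^sub>M law"
    unfolding measurable_cong_sets[OF refl sets] base_def observe_def
    using measurable_active_part by measurable
qed

lemma measure_law:
  assumes "Measurable.pred law Q"
  shows "measure law {x\<in>space law. Q x} = measure base {y\<in>space base. Q (observe y)}"
proof -
  have "measure law {x\<in>space law. Q x} = measure (distr base law observe) {x\<in>space law. Q x}"
    using law_eq by simp
  also have "\<dots> = measure base (observe -` {x\<in>space law. Q x} \<inter> space base)"
    using assms by (intro measure_distr measurable_observe) simp
  also have "observe -` {x\<in>space law. Q x} \<inter> space base = {y\<in>space base. Q (observe y)}"
    using measurable_space[OF measurable_observe] by auto
  finally show ?thesis .
qed

section \<open>Shift invariance of the joint law\<close>

text \<open>Data are pulled back: user \<open>i\<close> of the new outcome receives what user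
  \<open>next_user u i\<close> had, and the rows stay fixed. Restricting the functions to their
  index sets keeps them in the spaces of the product measures.\<close>

definition shift_outcome :: "outcome \<Rightarrow> outcome"
  where "shift_outcome y =
    (({i\<in>{..<u}. next_user u i \<in> users y},
      \<lambda>i\<in>{..<u}. {j\<in>{..<n}. block_shift u s j \<in> supports y (next_user u i)},
      \<lambda>j\<in>{..<n}. signal y (block_shift u s j)),
     \<lambda>j\<in>{..<n}. noise y (block_shift u s j), rows y)"

lemma distr_complex_normal_vec_shift:
  assumes "0 < w"
  shows "(\<lambda>g. \<lambda>j\<in>{..<n}. g (block_shift u s j)) \<in> complex_normal_vec n w \<rightarrow>\<^sub>M complex_normal_vec n w"
    and "distr (complex_normal_vec n w) (complex_normal_vec n w) (\<lambda>g. \<lambda>j\<in>{..<n}. g (block_shift u s j))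
      = complex_normal_vec n w"
  using distr_PiM_permute[of "{..<n}" "block_shift u s" "\<lambda>_. complex_normal w" "\<lambda>x. x"]
    bij_betw_block_shift prob_space_complex_normal[OF assms]
  by (auto simp: complex_normal_vec_def distr_id2)

text \<open>The support of \<open>next_user u i\<close> is uniform on the next block, and its
  preimage under the shift is uniform on block \<open>i\<close>, as the shift maps one block
  bijectively onto the other.\<close>

lemma distr_supports_law_shift:
  defines "f \<equiv> \<lambda>S :: nat \<Rightarrow> nat set. \<lambda>i\<in>{..<u}. {j\<in>{..<n}. block_shift u s j \<in> S (next_user u i)}"
  shows "f \<in> supports_law \<rightarrow>\<^sub>M supports_law" "distr supports_law supports_law f = supports_law"
proof -
  have bij: "bij_betw (block_shift u s) (block s i) (block s (next_user u i))"
    and pre: "{j \<in> {..<n}. block_shift u s j \<in> block s (next_user u i)} = block s i" if i: "i < u" for i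
  proof -
    have ni: "next_user u i < u" using i by (simp add: next_user_def)
    have sub: "block s i \<subseteq> {..<n}" "block s (next_user u i) \<subseteq> {..<n}" using i ni Union_block[of s u] by auto
    show pre: "{j \<in> {..<n}. block_shift u s j \<in> block s (next_user u i)} = block s i"
      using sub block_shift_in_block_iff[OF _ i, of _ s] by auto
    have "block_shift u s ` {j \<in> {..<n}. block_shift u s j \<in> block s (next_user u i)} = block s (next_user u i)"
      using sub(2) bij_betw_imp_surj_on[OF bij_betw_block_shift[of u s]] by (auto 4 3)
    then show "bij_betw (block_shift u s) (block s i) (block s (next_user u i))"
      using inj_on_subset[OF bij_betw_imp_inj_on[OF bij_betw_block_shift] sub(1)]
      unfolding pre by (simp add: bij_betw_def)
  qed
  note D = distr_uniform_subset[OF bij _ pre, where k=ks]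
  have fin: "finite (block s i)" for i by (simp add: block_def)
  show "f \<in> supports_law \<rightarrow>\<^sub>M supports_law" "distr supports_law supports_law f = supports_law"
    unfolding supports_law_def f_def
    using D fin
    by (intro distr_PiM_permute[where f="\<lambda>A. {j\<in>{..<n}. block_shift u s j \<in> A}"] bij_betw_next_user prob_space_support; simp)+
qed

text \<open>Each factor of \<open>base\<close> is invariant: the active set is a uniform subset
  pulled back along a permutation, the supports are covered by
  \<open>distr_supports_law_shift\<close>, gains and noise have i.i.d. coordinates, and the rows are
  untouched.\<close>

lemma shift_outcome_base:
  shows measurable_shift_outcome: "shift_outcome \<in> base \<rightarrow>\<^sub>M base"
    and distr_shift_outcome: "distr base base shift_outcome = base"
proof -
  let ?g = "\<lambda>g :: nat \<Rightarrow> complex. \<lambda>j\<in>{..<n}. g (block_shift u s j)"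
  let ?S = "\<lambda>S :: nat \<Rightarrow> nat set. \<lambda>i\<in>{..<u}. {j\<in>{..<n}. block_shift u s j \<in> S (next_user u i)}"
  let ?U = "\<lambda>U :: nat set. {i\<in>{..<u}. next_user u i \<in> U}"
  have "{i \<in> {..<u}. next_user u i \<in> {..<u}} = {..<u}"
    using bij_betwE[OF bij_betw_next_user[of u]] by auto
  note U = distr_uniform_subset[OF bij_betw_next_user _ this, of ku, folded users_law_def]
  note S = distr_supports_law_shift
  note g = distr_complex_normal_vec_shift[of 1, folded gains_law_def]
  note z = distr_complex_normal_vec_shift[OF v_pos, folded noise_law_def]
  have Sg: "(\<lambda>q. (?S (fst q), ?g (snd q))) \<in> supports_law \<Otimes>\<^sub>M gains_law \<rightarrow>\<^sub>M supports_law \<Otimes>\<^sub>M gains_law"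
    "distr (supports_law \<Otimes>\<^sub>M gains_law) (supports_law \<Otimes>\<^sub>M gains_law) (\<lambda>q. (?S (fst q), ?g (snd q)))
      = supports_law \<Otimes>\<^sub>M gains_law"
    using distr_pair_invariant[OF S(1) g(1) S(2) g(2) prob_space_gains_law] by simp_all
  have zr: "(\<lambda>q. (?g (fst q), snd q)) \<in> noise_rows_law \<rightarrow>\<^sub>M noise_rows_law"
    "distr noise_rows_law noise_rows_law (\<lambda>q. (?g (fst q), snd q)) = noise_rows_law"
    using distr_pair_invariant[OF z(1) _ z(2) _ prob_space_rows_law, of "\<lambda>x. x"]
    by (simp_all add: noise_rows_law_def distr_id2)
  note USg = distr_pair_invariant[OF U(1) Sg(1) U(2) Sg(2) prob_space_pair[OF prob_space_supports_law prob_space_gains_law]]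
  note all = distr_pair_invariant[OF USg(1) zr(1) USg(2) zr(2) prob_space_noise_rows_law]
  show "shift_outcome \<in> base \<rightarrow>\<^sub>M base" "distr base base shift_outcome = base"
    using all by (simp_all add: base_def shift_outcome_def[abs_def])
qed

lemma measure_shift_outcome:
  assumes "Measurable.pred base R"
  shows "measure base {y\<in>space base. R (shift_outcome y)} = measure base {y\<in>space base. R y}"
proof -
  have "measure base {y\<in>space base. R y} = measure (distr base base shift_outcome) {y\<in>space base. R y}"
    by (simp add: distr_shift_outcome)
  also have "\<dots> = measure base (shift_outcome -` {y\<in>space base. R y} \<inter> space base)"
    using assms by (intro measure_distr measurable_shift_outcome) simp
  also have "shift_outcome -` {y\<in>space base. R y} \<inter> space base = {y\<in>space base. R (shift_outcome y)}"
    using measurable_space[OF measurable_shift_outcome] by auto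
  finally show ?thesis by simp
qed

text \<open>Masking commutes with the shift: users and supports are pulled back together with the
  gains, so a coordinate is kept exactly when its image was.\<close>

lemma signal_observe_shift_outcome:
  assumes "j < n"
  shows "signal (observe (shift_outcome y)) j = signal (observe y) (block_shift u s j)"
proof -
  have s: "0 < s" using ks by simp
  show ?thesis
    using assms block_shift_less[OF assms] div_less_users[OF assms]
    by (simp add: observe_def active_part_def shift_outcome_def split_beta' block_shift_div[OF s])
qed

lemma users_observe [simp]: "users (observe y) = users y"
  and supports_observe [simp]: "supports (observe y) = supports y"
  and noise_observe [simp]: "noise (observe y) = noise y"
  and rows_observe [simp]: "rows (observe y) = rows y"
  by (simp_all add: observe_def active_part_def split_beta')

lemma energy_preserving_shift_outcome:
  "energy_preserving u s ks m \<epsilon> (signal (observe (shift_outcome y))) (noise (shift_outcome y)) (rows (shift_outcome y))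
    \<longleftrightarrow> energy_preserving u s ks m \<epsilon> (signal (observe y)) (noise y) (rows y)"
proof -
  have "rows (shift_outcome y) = rows y" by (simp add: shift_outcome_def)
  then show ?thesis
    using ku ks by (simp only:) (rule energy_preserving_shift, auto simp: signal_observe_shift_outcome,
      simp add: shift_outcome_def)
qed

section \<open>Ranges and measurability of the model variables\<close>

lemma in_space_law:
  assumes "x \<in> space law"
  shows "users x \<subseteq> {..<u}" "card (users x) = ku" "i < u \<Longrightarrow> supports x i \<in> Omega s ks i"
    "rows x \<subseteq> {..<n}"
proof -
  have "space (uniform_subset (block s i) ks) = Omega s ks i" for i
    by (simp add: space_uniform_subset Omega_def)
  then show "users x \<subseteq> {..<u}" "card (users x) = ku" "i < u \<Longrightarrow> supports x i \<in> Omega s ks i"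
    "rows x \<subseteq> {..<n}"
    using assms
    by (auto simp: law_def signal_law_def Let_def space_pair_measure noise_rows_law_def space_uniform_subset[of "{..<_}"]
      space_PiM PiE_def Pi_def)
qed

lemma sets_law [measurable_cong]:
  "sets law = sets ((users_law \<Otimes>\<^sub>M supports_law \<Otimes>\<^sub>M (\<Pi>\<^sub>M j\<in>{..<n}. borel)) \<Otimes>\<^sub>M
    ((\<Pi>\<^sub>M j\<in>{..<n}. borel) \<Otimes>\<^sub>M uniform_subset {..<n} m))"
  unfolding law_def signal_law_def Let_def noise_rows_law_def users_law_def supports_law_def
  by (intro sets_pair_measure_cong) (auto simp: sets_noise_law)

lemma pred_users [measurable]: "Measurable.pred law (\<lambda>x. i \<in> users x)"
  by (rule pred_mem_uniform_subset[where X="{..<u}" and k=ku]) (simp add: users_law_def[symmetric])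

lemma pred_supports:
  assumes "i < u"
  shows "Measurable.pred law (\<lambda>x. j \<in> supports x i)"
proof (rule pred_mem_uniform_subset)
  have 1: "(\<lambda>x. supports x) \<in> law \<rightarrow>\<^sub>M supports_law" by measurable
  have 2: "(\<lambda>S. S i) \<in> supports_law \<rightarrow>\<^sub>M uniform_subset (block s i) ks"
    using assms unfolding supports_law_def by simp
  show "(\<lambda>x. supports x i) \<in> law \<rightarrow>\<^sub>M uniform_subset (block s i) ks"
    by (rule measurable_compose[OF 1 2])
qed

lemma pred_rows [measurable]: "Measurable.pred law (\<lambda>x. k \<in> rows x)"
  by (rule pred_mem_uniform_subset[where X="{..<n}" and k=m]) measurable

lemma measurable_signal: "j < n \<Longrightarrow> (\<lambda>x. signal x j) \<in> borel_measurable law"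
  and measurable_noise: "j < n \<Longrightarrow> (\<lambda>x. noise x j) \<in> borel_measurable law"
  by simp_all

lemma measurable_path_energy:
  assumes i: "i < u"
  shows "path_energy i \<in> borel_measurable law"
proof -
  note [measurable] = measurable_signal measurable_noise pred_supports[OF i]
  \<comment> \<open>The random index set is traded for a fixed range with a measurable condition in
    each summand.\<close>
  have "path_energy i x = (\<Sum>j<n. if j \<in> supports x i then (cmod (signal x j + noise x j))\<^sup>2 else 0)"
    if "x \<in> space law" for x
    unfolding path_energy_def
    using Omega_subset[OF i in_space_law(3)[OF that i]] by (intro sum.mono_neutral_cong_left) auto
  moreover have "(\<lambda>x. \<Sum>j<n. if j \<in> supports x i then (cmod (signal x j + noise x j))\<^sup>2 else 0) \<in> borel_measurable law"
    by measurable
  ultimately show ?thesis by (simp cong: measurable_cong)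
qed

lemma measurable_linear_estimate:
  "(\<lambda>x. linear_estimate n m (signal x) (noise x) (rows x) j) \<in> borel_measurable law"
proof -
  note [measurable] = measurable_signal measurable_noise
  have "linear_estimate n m (signal x) (noise x) (rows x) j =
    (\<Sum>k<n. if k \<in> rows x then cnj (meas_matrix n m k j) * (\<Sum>l<n. meas_matrix n m k l * (signal x l + noise x l)) else 0)"
    if "x \<in> space law" for x
    unfolding linear_estimate_def adjoint_apply_def measurement_def
    using in_space_law(4)[OF that] by (intro sum.mono_neutral_cong_left) auto
  moreover have "(\<lambda>x. \<Sum>k<n. if k \<in> rows x then cnj (meas_matrix n m k j) * (\<Sum>l<n. meas_matrix n m k l * (signal x l + noise x l)) else 0) \<in> borel_measurable law"
    by measurable
  ultimately show ?thesis by (simp cong: measurable_cong)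
qed

lemma pred_energy_preserving:
  "Measurable.pred law (\<lambda>x. energy_preserving u s ks m \<epsilon> (signal x) (noise x) (rows x))"
proof -
  have D: "Measurable.pred law (\<lambda>x. \<bar>(\<Sum>j\<in>\<omega>. (cmod (signal x j + noise x j))\<^sup>2)
         - (\<Sum>j\<in>\<omega>. (cmod (linear_estimate n m (signal x) (noise x) (rows x) j))\<^sup>2)\<bar> \<le> \<epsilon>)"
    if \<omega>: "i < u" "\<omega> \<in> Omega s ks i" for i \<omega>
  proof -
    have "j < n" if "j \<in> \<omega>" for j using Omega_subset[OF \<omega>] that by auto
    then have [measurable]: "(\<lambda>x. \<Sum>j\<in>\<omega>. (cmod (signal x j + noise x j))\<^sup>2) \<in> borel_measurable law"
      by (intro borel_measurable_sum borel_measurable_power measurable_compose[OF _ borel_measurable_norm]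
        borel_measurable_add measurable_signal measurable_noise)
    have [measurable]: "(\<lambda>x. \<Sum>j\<in>\<omega>. (cmod (linear_estimate n m (signal x) (noise x) (rows x) j))\<^sup>2) \<in> borel_measurable law"
      by (intro borel_measurable_sum borel_measurable_power measurable_compose[OF measurable_linear_estimate borel_measurable_norm])
    show ?thesis by measurable
  qed
  have "Measurable.pred law (\<lambda>x. \<forall>i\<in>{..<u}. \<forall>\<omega>\<in>Omega s ks i. \<bar>(\<Sum>j\<in>\<omega>. (cmod (signal x j + noise x j))\<^sup>2)
         - (\<Sum>j\<in>\<omega>. (cmod (linear_estimate n m (signal x) (noise x) (rows x) j))\<^sup>2)\<bar> \<le> \<epsilon>)"
    by (rule pred_intros_finite(3)[OF finite_lessThan], rule pred_intros_finite(3)[OF finite_Omega], rule D) simp_all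
  moreover have "0 < u" using ku by simp
  ultimately show ?thesis
    by (simp only: energy_preserving_iff[OF _ ks(2)] Ball_def lessThan_iff)
qed

section \<open>Symmetry between the users\<close>

lemma prob_space_law: "prob_space law"
  using prob_space.prob_space_distr[OF prob_space_base measurable_observe] law_eq by simp

text \<open>For an invariant event \<open>C\<close> the shift turns "\<open>i\<close> is active and
  \<open>C\<close> holds" into the same event for the next user, so these \<open>u\<close> events
  are equally likely. Since exactly \<open>ku\<close> users are active in each outcome, their
  probabilities sum to \<open>ku\<close> times that of \<open>C\<close>.\<close>

lemma measure_users_inter:
  assumes C [measurable]: "Measurable.pred law C"
    and inv: "\<And>y. y \<in> space base \<Longrightarrow> C (observe (shift_outcome y)) \<longleftrightarrow> C (observe y)"
    and i: "i < u"
  shows "real u * measure law {x\<in>space law. i \<in> users x \<and> C x} = real ku * measure law {x\<in>space law. C x}"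
proof -
  interpret prob_space law by (rule prob_space_law)
  let ?a = "\<lambda>i. measure law {x\<in>space law. i \<in> users x \<and> C x}"
  have step: "?a i = ?a (next_user u i)" if "i < u" for i
  proof -
    note [measurable] = measurable_observe
    have "Measurable.pred base (\<lambda>y. i \<in> users y)" for i
      using measurable_compose[OF measurable_observe pred_users[of i]] by simp
    note [measurable] = this measurable_compose[OF measurable_observe C]
    have "?a i = measure base {y\<in>space base. i \<in> users y \<and> C (observe y)}"
      by (subst measure_law) auto
    also have "\<dots> = measure base {y\<in>space base. i \<in> users (shift_outcome y) \<and> C (observe (shift_outcome y))}"
      by (subst measure_shift_outcome[of "\<lambda>y. i \<in> users y \<and> C (observe y)"]) auto
    also have "\<dots> = measure base {y\<in>space base. next_user u i \<in> users y \<and> C (observe y)}"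
      using that inv by (intro arg_cong[where f="measure base"]) (auto simp: shift_outcome_def)
    also have "\<dots> = ?a (next_user u i)"
      by (subst measure_law) auto
    finally show ?thesis .
  qed
  \<comment> \<open>Stepping up from user 0 reaches every \<open>i < u\<close> without wrapping
    around.\<close>
  have const: "?a i = ?a 0" if "i < u" for i
    using that
  proof (induction i)
    case (Suc i)
    then have "next_user u i = Suc i" by (simp add: next_user_def)
    with Suc step[of i] show ?case by simp
  qed simp
  have "(\<Sum>i<u. ?a i) = real ku * measure law {x\<in>space law. C x}"
  proof (rule sum_measure_const_card)
    fix x assume "x \<in> {x \<in> space law. C x}"
    then have "{i \<in> {..<u}. x \<in> {x \<in> space law. i \<in> users x \<and> C x}} = users x"
      using in_space_law(1)[of x] by auto
    then show "card {i \<in> {..<u}. x \<in> {x \<in> space law. i \<in> users x \<and> C x}} = ku"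
      using \<open>x \<in> {x \<in> space law. C x}\<close> in_space_law(2)[of x] by simp
  qed auto
  moreover have "(\<Sum>l<u. ?a l) = (\<Sum>l<u. ?a i)"
    by (intro sum.cong refl trans[OF const const[OF i, symmetric]]) simp
  ultimately show ?thesis by simp
qed

section \<open>Comparing a noise entry with the path energy\<close>

lemma nn_integral_base:
  assumes f: "f \<in> borel_measurable base"
  shows "(\<integral>\<^sup>+x. f x \<partial>base) = (\<integral>\<^sup>+U. \<integral>\<^sup>+S. \<integral>\<^sup>+g. \<integral>\<^sup>+z. \<integral>\<^sup>+R. f ((U, S, g), z, R)
    \<partial>uniform_subset {..<n} m \<partial>noise_law n m \<sigma> \<partial>gains_law \<partial>supports_law \<partial>users_law)"
proof -
  interpret rows: prob_space "uniform_subset {..<n} m" by (rule prob_space_rows_law)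
  interpret noise_rows: prob_space noise_rows_law by (rule prob_space_noise_rows_law)
  interpret gains: prob_space gains_law by (rule prob_space_gains_law)
  interpret sg: prob_space "supports_law \<Otimes>\<^sub>M gains_law"
    by (intro prob_space_pair prob_space_supports_law prob_space_gains_law)
  define F where "F q = (\<integral>\<^sup>+y. f (q, y) \<partial>noise_rows_law)" for q
  have fx: "(\<lambda>y. f (q, y)) \<in> borel_measurable noise_rows_law"
    if "q \<in> space (users_law \<Otimes>\<^sub>M supports_law \<Otimes>\<^sub>M gains_law)" for q
    using that f unfolding base_def by (rule measurable_compose_Pair1)
  have F: "F \<in> borel_measurable (users_law \<Otimes>\<^sub>M supports_law \<Otimes>\<^sub>M gains_law)"
    using f unfolding F_def base_def by (rule noise_rows.borel_measurable_nn_integral_fst)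
  have FU: "(\<lambda>q. F (U, q)) \<in> borel_measurable (supports_law \<Otimes>\<^sub>M gains_law)" if "U \<in> space users_law" for U
    using that F by (rule measurable_compose_Pair1)
  have "(\<integral>\<^sup>+x. f x \<partial>base) = (\<integral>\<^sup>+q. F q \<partial>(users_law \<Otimes>\<^sub>M supports_law \<Otimes>\<^sub>M gains_law))"
    using f unfolding F_def base_def by (rule noise_rows.nn_integral_fst[symmetric])
  also have "\<dots> = (\<integral>\<^sup>+U. \<integral>\<^sup>+q. F (U, q) \<partial>(supports_law \<Otimes>\<^sub>M gains_law) \<partial>users_law)"
    using F by (rule sg.nn_integral_fst[symmetric])
  also have "\<dots> = (\<integral>\<^sup>+U. \<integral>\<^sup>+S. \<integral>\<^sup>+g. F (U, S, g) \<partial>gains_law \<partial>supports_law \<partial>users_law)"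
    using FU by (intro nn_integral_cong gains.nn_integral_fst[symmetric])
  also have "\<dots> = (\<integral>\<^sup>+U. \<integral>\<^sup>+S. \<integral>\<^sup>+g. \<integral>\<^sup>+z. \<integral>\<^sup>+R. f ((U, S, g), z, R)
    \<partial>uniform_subset {..<n} m \<partial>noise_law n m \<sigma> \<partial>gains_law \<partial>supports_law \<partial>users_law)"
    unfolding F_def noise_rows_law_def
    using fx by (intro nn_integral_cong rows.nn_integral_fst[symmetric])
      (simp add: noise_rows_law_def space_pair_measure)
  finally show ?thesis .
qed

text \<open>For fixed users and supports the probability is at most
  \<open>(2 * real ks * v) ^ ks\<close>, by \<open>sum_energy_le_noise\<close> with
  \<open>\<kappa> = 2 * real ks\<close>, or zero if \<open>i\<close> is inactive or the user of
  \<open>j\<close> is active. The right-hand event keeps this condition, so that summing over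
  \<open>j\<close> counts inactive entries only.\<close>

lemma measure_noise_exceeds:
  assumes i: "i < u" and j: "j < n"
  shows "measure law {x\<in>space law. i \<in> users x \<and> j div s \<notin> users x \<and>
      path_energy i x \<le> 2 * real ks * (cmod (signal x j + noise x j))\<^sup>2}
    \<le> (2 * real ks * v) ^ ks * measure law {x\<in>space law. i \<in> users x \<and> j div s \<notin> users x}"
    (is "measure law {x\<in>space law. ?Q x} \<le> ?c * measure law {x\<in>space law. ?D x}")
proof -
  interpret base: prob_space base by (rule prob_space_base)
  interpret rows: prob_space "uniform_subset {..<n} m" by (rule prob_space_rows_law)
  interpret noise: prob_space "noise_law n m \<sigma>" by (rule prob_space_noise_law)
  interpret gains: prob_space gains_law by (rule prob_space_gains_law)
  note [measurable] = measurable_path_energy[OF i] measurable_signal[OF j] measurable_noise[OF j]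
  have s: "0 < s" using ks by simp
  have c: "0 \<le> ?c" by simp
  have Q [measurable]: "Measurable.pred law ?Q" and D [measurable]: "Measurable.pred law ?D" by measurable
  let ?A = "{y\<in>space base. ?Q (observe y)}" and ?B = "{y\<in>space base. ?D y}"
  have A: "?A \<in> sets base" and B: "?B \<in> sets base"
    using measurable_compose[OF measurable_observe Q] measurable_compose[OF measurable_observe D] by auto
  have "emeasure base ?A = (\<integral>\<^sup>+y. indicator ?A y \<partial>base)"
    using A by simp
  also have "\<dots> = (\<integral>\<^sup>+U. \<integral>\<^sup>+S. \<integral>\<^sup>+g. \<integral>\<^sup>+z. \<integral>\<^sup>+R. indicator ?A ((U, S, g), z, R)
    \<partial>uniform_subset {..<n} m \<partial>noise_law n m \<sigma> \<partial>gains_law \<partial>supports_law \<partial>users_law)"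
    using A by (intro nn_integral_base) simp
  also have "\<dots> \<le> (\<integral>\<^sup>+U. \<integral>\<^sup>+S. \<integral>\<^sup>+g. \<integral>\<^sup>+z. \<integral>\<^sup>+R. ennreal ?c * indicator ?B ((U, S, g), z, R)
    \<partial>uniform_subset {..<n} m \<partial>noise_law n m \<sigma> \<partial>gains_law \<partial>supports_law \<partial>users_law)"
  proof (rule nn_integral_mono, rule nn_integral_mono)
    \<comment> \<open>Users and supports are the outermost integrals. Once they are fixed,
      \<open>S i\<close> is a deterministic index set and only gains and noise matter.\<close>
    fix U S assume US: "U \<in> space users_law" "S \<in> space supports_law"
    have Si: "S i \<subseteq> block s i" "card (S i) = ks"
      using US(2) i by (auto simp: supports_law_def space_PiM space_uniform_subset PiE_def Pi_def)
    show "(\<integral>\<^sup>+g. \<integral>\<^sup>+z. \<integral>\<^sup>+R. indicator ?A ((U, S, g), z, R)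
        \<partial>uniform_subset {..<n} m \<partial>noise_law n m \<sigma> \<partial>gains_law)
      \<le> (\<integral>\<^sup>+g. \<integral>\<^sup>+z. \<integral>\<^sup>+R. ennreal ?c * indicator ?B ((U, S, g), z, R)
        \<partial>uniform_subset {..<n} m \<partial>noise_law n m \<sigma> \<partial>gains_law)"
    proof (cases "i \<in> U \<and> j div s \<notin> U")
      case False
      then have "indicator ?A ((U, S, g), z, R) = (0 :: ennreal)" for g z R
        by auto
      then show ?thesis by simp
    next
      case True
      let ?P = "gains_law \<Otimes>\<^sub>M noise_law n m \<sigma>"
      let ?W = "{x\<in>space ?P. (\<Sum>l\<in>S i. (cmod (fst x l + snd x l))\<^sup>2) \<le> 2 * real ks * (cmod (snd x j))\<^sup>2}"
      have Sn: "S i \<subseteq> {..<n}" using Si(1) i Union_block[of s u] by auto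
      have "j \<notin> S i" using True Si(1) in_block_iff[OF s] by auto
      \<comment> \<open>On \<open>S i\<close> the mask of the active user \<open>i\<close> lets
        \<open>g\<close> through, while at \<open>j\<close> the user is inactive and the signal is
        zero. The event is thus one about \<open>g\<close> and \<open>z\<close> alone.\<close>
      have "path_energy i (observe ((U, S, g), z, R)) = (\<Sum>l\<in>S i. (cmod (g l + z l))\<^sup>2)" for g z R
        unfolding path_energy_def using True Si(1) Sn in_block_iff[OF s]
        by (intro sum.cong) (auto simp: observe_def active_part_def subset_eq)
      moreover have "signal (observe ((U, S, g), z, R)) j = 0" for g z R
        using True j by (simp add: observe_def active_part_def)
      ultimately have "indicator ?A ((U, S, g), z, R) \<le> (indicator ?W (g, z) :: ennreal)" for g z R
        by (auto simp: base_def noise_rows_law_def space_pair_measure split: split_indicator)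
      then have "(\<integral>\<^sup>+g. \<integral>\<^sup>+z. \<integral>\<^sup>+R. indicator ?A ((U, S, g), z, R)
        \<partial>uniform_subset {..<n} m \<partial>noise_law n m \<sigma> \<partial>gains_law) \<le>
        (\<integral>\<^sup>+g. \<integral>\<^sup>+z. \<integral>\<^sup>+R. indicator ?W (g, z)
        \<partial>uniform_subset {..<n} m \<partial>noise_law n m \<sigma> \<partial>gains_law)"
        by (intro nn_integral_mono)
      also have "\<dots> = (\<integral>\<^sup>+g. \<integral>\<^sup>+z. indicator ?W (g, z) \<partial>noise_law n m \<sigma> \<partial>gains_law)"
        by (simp add: rows.emeasure_space_1)
      also have "\<dots> = emeasure ?P ?W"
      proof -
        have "(\<lambda>x. fst x l) \<in> borel_measurable ?P" "(\<lambda>x. snd x l) \<in> borel_measurable ?P" if "l < n" for l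
          using that by simp_all
        then have [measurable]: "(\<lambda>x. \<Sum>l\<in>S i. (cmod (fst x l + snd x l))\<^sup>2) \<in> borel_measurable ?P"
          "(\<lambda>x. snd x j) \<in> borel_measurable ?P"
          using Sn j by (auto intro!: borel_measurable_sum)
        have "?W \<in> sets ?P" by measurable
        then show ?thesis by (subst noise.nn_integral_fst) auto
      qed
      also have "\<dots> \<le> ennreal ?c"
        using sum_energy_le_noise[OF v_pos _ Sn j \<open>j \<notin> S i\<close>, of "2 * real ks"] ks(1)
        by (simp only: gains_law_def noise_law_def Si(2))
      also have "\<dots> = (\<integral>\<^sup>+g. \<integral>\<^sup>+z. \<integral>\<^sup>+R. ennreal ?c
        \<partial>uniform_subset {..<n} m \<partial>noise_law n m \<sigma> \<partial>gains_law)"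
        by (simp only: nn_integral_const rows.emeasure_space_1 noise.emeasure_space_1 gains.emeasure_space_1 mult_1_right)
      also have "\<dots> = (\<integral>\<^sup>+g. \<integral>\<^sup>+z. \<integral>\<^sup>+R. ennreal ?c * indicator ?B ((U, S, g), z, R)
        \<partial>uniform_subset {..<n} m \<partial>noise_law n m \<sigma> \<partial>gains_law)"
        using US True by (intro nn_integral_cong) (simp add: base_def noise_rows_law_def space_pair_measure)
      finally show ?thesis .
    qed
  qed
  also have "\<dots> = (\<integral>\<^sup>+y. ennreal ?c * indicator ?B y \<partial>base)"
    by (intro nn_integral_base[symmetric] borel_measurable_times_ennreal measurable_const
      borel_measurable_indicator B) simp
  also have "\<dots> = ennreal ?c * emeasure base ?B"
    using B by (rule nn_integral_cmult_indicator)
  finally have "measure base ?A \<le> ?c * measure base ?B"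
    using c by (simp add: base.emeasure_eq_measure flip: ennreal_mult)
  then show ?thesis
    using measure_law[OF Q] measure_law[OF D] by simp
qed

section \<open>Activity, failure and the number of inactive entries\<close>

lemma card_inactive:
  assumes "U \<subseteq> {..<u}" "card U = ku"
  shows "card {j\<in>{..<n}. j div s \<notin> U} = s * (u - ku)"
proof -
  have s: "0 < s" using ks by simp
  have "{j\<in>{..<n}. j div s \<notin> U} = (\<Union>i\<in>{..<u} - U. block s i)"
    using in_block_iff[OF s] by (auto simp: Union_block[symmetric])
  also have "card \<dots> = (\<Sum>i\<in>{..<u} - U. card (block s i))"
  proof (rule card_UN_disjoint)
    show "\<forall>i\<in>{..<u} - U. finite (block s i)" by (simp add: block_def)
    show "\<forall>i\<in>{..<u} - U. \<forall>i'\<in>{..<u} - U. i \<noteq> i' \<longrightarrow> block s i \<inter> block s i' = {}"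
      using in_block_iff[OF s] by auto
  qed simp
  also have "\<dots> = s * (u - ku)"
    using assms finite_subset[OF assms(1)] by (simp add: block_def card_Diff_subset)
  finally show ?thesis .
qed

lemma measure_users: "i < u \<Longrightarrow> real u * measure law {x\<in>space law. i \<in> users x} = real ku"
  using measure_users_inter[of "\<lambda>_. True" i] prob_space.prob_space[OF prob_space_law] by simp

text \<open>Failure is invariant under the shift, so \<open>measure_users_inter\<close> applies to
  it and, through \<open>measure_users\<close>, to the sure event; comparing the two gives
  independence. This is what allows an unconditional failure probability in a bound conditional on
  activity.\<close>

lemma measure_users_not_energy_preserving:
  assumes "i < u"
  shows "measure law {x\<in>space law. i \<in> users x \<and> \<not> energy_preserving u s ks m \<epsilon> (signal x) (noise x) (rows x)}
    = measure law {x\<in>space law. i \<in> users x}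
      * measure law {x\<in>space law. \<not> energy_preserving u s ks m \<epsilon> (signal x) (noise x) (rows x)}"
proof -
  have "real u * (measure law {x\<in>space law. i \<in> users x \<and> \<not> energy_preserving u s ks m \<epsilon> (signal x) (noise x) (rows x)})
     = real u * (measure law {x\<in>space law. i \<in> users x}
      * measure law {x\<in>space law. \<not> energy_preserving u s ks m \<epsilon> (signal x) (noise x) (rows x)})"
    unfolding mult.assoc[symmetric] measure_users[OF assms]
    using pred_energy_preserving[of \<epsilon>] energy_preserving_shift_outcome[of \<epsilon>]
    by (intro measure_users_inter assms) simp_all
  then show ?thesis using assms by simp
qed

text \<open>Every outcome has exactly \<open>s * (u - ku)\<close> coordinates in inactive blocks, so
  this is double counting on the event that \<open>i\<close> is active.\<close>

lemma sum_measure_inactive: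
  "(\<Sum>j<n. measure law {x\<in>space law. i \<in> users x \<and> j div s \<notin> users x})
    = real s * (real u - real ku) * measure law {x\<in>space law. i \<in> users x}"
proof -
  interpret prob_space law by (rule prob_space_law)
  have "(\<Sum>j<n. measure law {x\<in>space law. i \<in> users x \<and> j div s \<notin> users x})
    = real (s * (u - ku)) * measure law {x\<in>space law. i \<in> users x}"
  proof (rule sum_measure_const_card)
    fix x assume x: "x \<in> {x \<in> space law. i \<in> users x}"
    then show "card {j \<in> {..<n}. x \<in> {x \<in> space law. i \<in> users x \<and> j div s \<notin> users x}} = s * (u - ku)"
      using card_inactive[OF in_space_law(1,2), of x] by simp
  qed auto
  then show ?thesis using ku by (simp add: of_nat_diff)
qed

section \<open>Assembling the bound\<close>

lemma noise_term_eq: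
  "real n powi (- int ks) * SNR \<sigma> powi (- int ks) * (real u * real s / (2 * real ks * real m)) powi (- int ks)
    = (2 * real ks * v) ^ ks"
proof -
  have "real n powi (- int ks) * SNR \<sigma> powi (- int ks) * (real u * real s / (2 * real ks * real m)) powi (- int ks)
    = (real n * SNR \<sigma> * (real u * real s / (2 * real ks * real m))) powi (- int ks)"
    by (simp only: power_int_mult_distrib)
  \<comment> \<open>The explicit factor \<open>n\<close> and the factor \<open>u * s = n\<close> in
    the last ratio supply the \<open>n^2\<close> in the noise variance \<open>v\<close>.\<close>
  also have "real n * SNR \<sigma> * (real u * real s / (2 * real ks * real m)) = inverse (2 * real ks * v)"
    by (simp add: SNR_def field_simps power2_eq_square)
  also have "inverse (2 * real ks * v) powi (- int ks) = (2 * real ks * v) ^ ks"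
    by (simp only: power_int_minus power_int_inverse power_inverse inverse_inverse_eq power_int_of_nat)
  finally show ?thesis .
qed

text \<open>Three kinds of event, each intersected with activity of \<open>i\<close>, cover a miss.
  Each total is at most \<open>a\<close> times a term of the bound, where \<open>a\<close> is the
  probability that \<open>i\<close> is active; dividing by \<open>a\<close> gives the conditional
  statement.\<close>

lemma P_md_le:
  fixes M :: "'w measure" and i :: nat
  assumes i: "i < u" and \<xi>: "0 \<le> \<xi>" and \<epsilon>: "0 < \<epsilon>"
    and model: "access_model M u s ku ks m \<sigma> act supp h z B"
    and threshold: "\<And>w. w \<in> space M \<Longrightarrow> hier_threshold u s ku ks (linear_estimate n m (h w) (z w) (B w)) (L w)"
  shows "P_md M u s m act h z B L i \<xi>
    \<le> P_sRIP_fail M u s ks m h z B \<epsilon>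
      + 2 * real s * (real u - real ku) * F_z M act supp h z i (\<xi> + 4 * \<epsilon>)
      + (2 * real ks * v) ^ ks * (real s * (real u - real ku))"
proof -
  define X where "X w = ((act w, supp w, h w), z w, B w)" for w
  have M: "prob_space M" and X [measurable]: "X \<in> M \<rightarrow>\<^sub>M law" and dX: "distr M law X = law"
    using model by (simp_all add: access_model_def Let_def law_def noise_rows_law_def X_def[abs_def])
  interpret prob_space M by (rule M)
  have ev: "{w\<in>space M. Q (X w)} \<in> events" and pr: "prob {w\<in>space M. Q (X w)} = measure law {x\<in>space law. Q x}"
    if Q: "Measurable.pred law Q" for Q
  proof -
    show "{w\<in>space M. Q (X w)} \<in> events"
      using measurable_compose[OF X Q] by simp
    have "{w\<in>space M. Q (X w)} = X -` {x\<in>space law. Q x} \<inter> space M"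
      using measurable_space[OF X] by auto
    then show "prob {w\<in>space M. Q (X w)} = measure law {x\<in>space law. Q x}"
      using measure_distr[OF X, of "{x\<in>space law. Q x}"] Q dX by simp
  qed
  note [measurable] = measurable_path_energy[OF i] measurable_signal measurable_noise pred_energy_preserving
  let ?ep = "\<lambda>x. energy_preserving u s ks m \<epsilon> (signal x) (noise x) (rows x)"
  let ?T = "\<lambda>w. \<not> declared_active s \<xi> (linear_estimate (u * s) m (h w) (z w) (B w)) (L w) i"
  let ?Q = "\<lambda>j x. i \<in> users x \<and> j div s \<notin> users x \<and>
      path_energy i x \<le> 2 * real ks * (cmod (signal x j + noise x j))\<^sup>2"
  let ?c = "(2 * real ks * v) ^ ks"
  define a where "a = prob {w\<in>space M. i \<in> act w}"
  have a: "a = measure law {x\<in>space law. i \<in> users x}"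
    using pr[of "\<lambda>x. i \<in> users x"] by (simp add: a_def X_def)
  \<comment> \<open>By symmetry \<open>u * a = ku > 0\<close>, so conditioning on activity is
    conditioning on an event of positive probability.\<close>
  have "a \<noteq> 0" using measure_users[OF i] ku by (auto simp: a)
  then have a0: "0 < a" by (simp add: a_def zero_less_measure_iff)
  define Fz where "Fz = prob {w\<in>space M. path_energy i (X w) \<le> \<xi> + 4 * \<epsilon> \<and> i \<in> users (X w)}"
  have fail: "prob {w\<in>space M. i \<in> users (X w) \<and> \<not> ?ep (X w)} = a * P_sRIP_fail M u s ks m h z B \<epsilon>"
  proof -
    have "P_sRIP_fail M u s ks m h z B \<epsilon> = measure law {x\<in>space law. \<not> ?ep x}"
      using pr[of "\<lambda>x. \<not> ?ep x"] by (simp add: P_sRIP_fail_def X_def)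
    then show ?thesis
      using pr[of "\<lambda>x. i \<in> users x \<and> \<not> ?ep x"] measure_users_not_energy_preserving[OF i] by (simp add: a)
  qed
  have low: "Fz = a * F_z M act supp h z i (\<xi> + 4 * \<epsilon>)"
    using a0 by (simp add: F_z_def cond_prob_def Fz_def a_def X_def path_energy_def norm_on_sq)
  \<comment> \<open>The sum runs over all coordinates, but the events of coordinates in active
    blocks are empty, which leaves the factor \<open>s * (u - ku)\<close>.\<close>
  have exceed: "(\<Sum>j<n. prob {w\<in>space M. ?Q j (X w)}) \<le> ?c * (real s * (real u - real ku)) * a"
  proof -
    have "(\<Sum>j<n. prob {w\<in>space M. ?Q j (X w)}) = (\<Sum>j<n. measure law {x\<in>space law. ?Q j x})"
      by (intro sum.cong refl pr) simp
    also have "\<dots> \<le> (\<Sum>j<n. ?c * measure law {x\<in>space law. i \<in> users x \<and> j div s \<notin> users x})"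
      by (intro sum_mono measure_noise_exceeds i) simp
    also have "\<dots> = ?c * (real s * (real u - real ku)) * a"
      by (simp only: sum_distrib_left[symmetric] sum_measure_inactive a mult.assoc)
    finally show ?thesis .
  qed
  have cover: "{w\<in>space M. ?T w \<and> i \<in> act w} \<subseteq> {w\<in>space M. i \<in> users (X w) \<and> \<not> ?ep (X w)} \<union>
    {w\<in>space M. path_energy i (X w) \<le> \<xi> + 4 * \<epsilon> \<and> i \<in> users (X w)} \<union>
    (\<Union>j<n. {w\<in>space M. ?Q j (X w)})"
  proof
    fix w assume "w \<in> {w\<in>space M. ?T w \<and> i \<in> act w}"
    then have w: "w \<in> space M" "?T w" "i \<in> act w" by auto
    show "w \<in> {w\<in>space M. i \<in> users (X w) \<and> \<not> ?ep (X w)} \<union>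
      {w\<in>space M. path_energy i (X w) \<le> \<xi> + 4 * \<epsilon> \<and> i \<in> users (X w)} \<union>
      (\<Union>j<n. {w\<in>space M. ?Q j (X w)})"
    proof (cases "?ep (X w)")
      case True
      have sp: "X w \<in> space law" using measurable_space[OF X w(1)] .
      have u0: "0 < u" using i by simp
      have "path_energy i (X w) \<le> \<xi> + 4 * \<epsilon> \<or>
        (\<exists>j<u * s. j div s \<notin> act w \<and> path_energy i (X w) \<le> 2 * real ks * (cmod (h w j + z w j))\<^sup>2)"
        unfolding path_energy_def X_def fst_conv snd_conv
      proof (rule missed_user_cases[OF _ ks(1) i w(3)])
        show "act w \<subseteq> {..<u}" "card (act w) = ku" "supp w i \<in> Omega s ks i"
          using in_space_law[OF sp] i by (simp_all add: X_def)
        show "hier_threshold u s ku ks (linear_estimate (u * s) m (h w) (z w) (B w)) (L w)"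
          by (rule threshold[OF w(1)])
        show "\<bar>(\<Sum>j\<in>\<omega>. (cmod (h w j + z w j))\<^sup>2) -
          (\<Sum>j\<in>\<omega>. (cmod (linear_estimate (u * s) m (h w) (z w) (B w) j))\<^sup>2)\<bar> \<le> \<epsilon>"
          if "i < u" "\<omega> \<in> Omega s ks i" for i \<omega>
          using True that by (simp add: X_def energy_preserving_iff[OF u0 ks(2)])
      qed (use w(2) ks \<xi> \<epsilon> in auto)
      then show ?thesis using w(1,3) by (auto simp: X_def)
    qed (use w in \<open>simp add: X_def\<close>)
  qed
  have "prob {w\<in>space M. ?T w \<and> i \<in> act w} \<le> a * P_sRIP_fail M u s ks m h z B \<epsilon> + Fz
      + ?c * (real s * (real u - real ku)) * a"
  proof -
    have Qj: "{w\<in>space M. ?Q j (X w)} \<in> events" if "j < n" for j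
      using that by (intro ev) simp
    have F1: "{w\<in>space M. i \<in> users (X w) \<and> \<not> ?ep (X w)} \<in> events"
      by (intro ev[of "\<lambda>x. i \<in> users x \<and> \<not> ?ep x"]) measurable
    have F2: "{w\<in>space M. path_energy i (X w) \<le> \<xi> + 4 * \<epsilon> \<and> i \<in> users (X w)} \<in> events"
      by (intro ev[of "\<lambda>x. path_energy i x \<le> \<xi> + 4 * \<epsilon> \<and> i \<in> users x"]) measurable
    have U: "(\<Union>j<n. {w\<in>space M. ?Q j (X w)}) \<in> events"
      using Qj by (intro sets.finite_UN) auto
    have "prob (\<Union>j<n. {w\<in>space M. ?Q j (X w)}) \<le> (\<Sum>j<n. prob {w\<in>space M. ?Q j (X w)})"
      using Qj by (intro finite_measure_subadditive_finite) auto
    then show ?thesis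
      using finite_measure_mono[OF cover sets.Un[OF sets.Un[OF F1 F2] U]]
        measure_Un_le[OF sets.Un[OF F1 F2] U] measure_Un_le[OF F1 F2]
        fail exceed
      unfolding Fz_def by linarith
  qed
  then have "prob {w\<in>space M. ?T w \<and> i \<in> act w} \<le> (P_sRIP_fail M u s ks m h z B \<epsilon> +
      F_z M act supp h z i (\<xi> + 4 * \<epsilon>) + ?c * (real s * (real u - real ku))) * a"
    unfolding low by (simp only: distrib_right mult.commute[of a])
  then have "P_md M u s m act h z B L i \<xi> \<le> P_sRIP_fail M u s ks m h z B \<epsilon> +
      F_z M act supp h z i (\<xi> + 4 * \<epsilon>) + ?c * (real s * (real u - real ku))"
    unfolding P_md_def cond_prob_def a_def[symmetric] by (simp only: pos_divide_le_eq[OF a0])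
  \<comment> \<open>The union bound yields \<open>F_z\<close> with coefficient one, and
    \<open>2 * s * (u - ku) \<ge> 1\<close> because \<open>s \<ge> 1\<close> and
    \<open>ku < u\<close>.\<close>
  moreover have "F_z M act supp h z i (\<xi> + 4 * \<epsilon>) \<le>
      2 * real s * (real u - real ku) * F_z M act supp h z i (\<xi> + 4 * \<epsilon>)"
  proof -
    have "1 * 1 \<le> (2 * real s) * (real u - real ku)"
      using ks ku by (intro mult_mono) auto
    moreover have "0 \<le> F_z M act supp h z i (\<xi> + 4 * \<epsilon>)" by (simp add: F_z_def cond_prob_def)
    ultimately show ?thesis using mult_right_mono[of 1 "2 * real s * (real u - real ku)" "F_z M act supp h z i (\<xi> + 4 * \<epsilon>)"] by simp
  qed
  ultimately show ?thesis by linarith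
qed

end

theorem theorem4:
  fixes M :: "'w measure"
    and u s n ku ks m i :: nat and \<sigma> \<xi> \<epsilon> :: real
    and act :: "'w \<Rightarrow> nat set" and supp :: "'w \<Rightarrow> nat \<Rightarrow> nat set"
    and h z :: "'w \<Rightarrow> nat \<Rightarrow> complex" and B L :: "'w \<Rightarrow> nat set"
  assumes "n = u * s" and "0 < ku" "ku < u" "0 < ks" "ks \<le> s" "0 < m" "m \<le> n"
    and "0 < \<sigma>" "0 \<le> \<xi>" "0 < \<epsilon>" "i < u"
    and "access_model M u s ku ks m \<sigma> act supp h z B"
    and "L \<in> M \<rightarrow>\<^sub>M count_space (Pow {..<n})"
    and "\<And>w. w \<in> space M \<Longrightarrow>
      hier_threshold u s ku ks (linear_estimate n m (h w) (z w) (B w)) (L w)"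
  shows "P_md M u s m act h z B L i \<xi>
    \<le> P_sRIP_fail M u s ks m h z B \<epsilon>
      + 2 * real s * (real u - real ku) * F_z M act supp h z i (\<xi> + 4 * \<epsilon>)
      + real n powi (- int ks) * SNR \<sigma> powi (- int ks)
        * (real u * real s / (2 * real ks * real m)) powi (- int ks)
        * real s * (real u - real ku)"
proof -
  interpret access_params u s ku ks m \<sigma>
    using assms by unfold_locales auto
  show ?thesis
    using P_md_le[of i \<xi> \<epsilon> M act supp h z B L] assms noise_term_eq
    by (simp only: mult.assoc)
qed

end
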